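(* Let $T\subset S^dU$ be a special vector space of dimension $e+1$, of type $T=\partial^{b_1}(m_1)\oplus\partial^{b_2}(m_2)\oplus\cdots\oplus\partial^{b_r}(m_r)$, where every $m_i$ is a monomial (so that the associated partition is $(\gamma_1,\dots,\gamma_r)=(b_1+2,\dots,b_r+2)$), and let $\lambda=e+1+r$ be its height. Let $f:\mathbb{P}^1\to\mathbb{P}^s$ be the rational curve associated with $T$ and let $\varphi(k)=h^0(\mathbb{P}^1,\mathcal{N}_f(-d-2-k))$. Then for every integer $k\in[2,\lambda]$: $$\varphi(k)=\sum_{i=1}^{r}(b_i-k+1)+\lambda-k+1+\sum_{i=1}^{r-1}[[k-b_{i+1}-b_i-3]]+[[k-b_1-2]]+[[k-b_r-2]],$$ and $$\Delta^2\varphi(k)=\sum_{i=1}^{r-1}\delta(k,\,b_i+b_{i+1}+2)+\delta(k,\,b_1+1)+\delta(k,\,b_r+1),$$ where $\delta(u,v)=1$ if $u=v$ and $\delta(u,v)=0$ otherwise.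
   Context: Work over $\mathbb{C}$. $U=\langle x,y\rangle$ is a 2-dimensional vector space, $\mathbb{P}^1=\mathbb{P}(U)$, and $S^dU$ is identified with homogeneous polynomials of degree $d$ in $x,y$. $\Gamma_d\subset\mathbb{P}(S^dU)=\mathbb{P}^d$ is the rational normal curve of $d$-th powers of linear forms. For a subspace $T\subset S^dU$ of dimension $e+1=d-s$ ($d>s\ge 3$) with $\mathbb{P}(T)\cap\Gamma_d=\emptyset$, the associated rational curve is the morphism $f:\mathbb{P}^1\to\mathbb{P}^s=\mathbb{P}(S^dU/T)$, the composition of the $d$-Veronese embedding $\alpha x+\beta y\mapsto(\alpha x+\beta y)^d$ with the projection from $\mathbb{P}(T)$. $\mathcal{N}_f$ is the cokernel of the differential $\mathcal{T}_{\mathbb{P}^1}\to f^*\mathcal{T}_{\mathbb{P}^s}$. Put $\Delta^2\varphi(k)=\varphi(k+2)-2\varphi(k+1)+\varphi(k)$. For $z\in\mathbb{Z}$, $[[z]]=\max\{0,z\}$. For a subspace $W\subset S^nU$, $\partial W\subset S^{n-1}U$ is the span of $\partial_x(W)$ and $\partial_y(W)$, and $\partial^kW$ is the $k$-fold iterate ($\partial^0W=W$); for a polynomial $g$, $\partial^k(g)$ means $\partial^k\langle g\rangle$. Special vector space: $T\subset S^dU$ is special if there are an integer $r\ge 2$ and integers $2\le\alpha_1\le\beta_1<\alpha_2\le\beta_2<\dots<\alpha_r\le\beta_r\le d-2$ with $\alpha_{i+1}=\beta_i+2$ for $i=1,\dots,r-1$, such that $T$ is spanned by the monomials $x^{d-j}y^j$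 with $j\in\bigcup_{i=1}^r[\alpha_i,\beta_i]$. Equivalently, $T=\partial^{\gamma_1-2}(m_1)\oplus\cdots\oplus\partial^{\gamma_r-2}(m_r)$ where $m_i=x^{d-\alpha_i}y^{\beta_i}$ (of degree $d+\gamma_i-2$) and $\gamma_i=\beta_i-\alpha_i+2\ge 2$, and $\partial T=\partial^{\lambda-1}(h)$ where $h=x^{d-\alpha_1}y^{\beta_r}$ and $\lambda=\gamma_1+\cdots+\gamma_r=\beta_r-\alpha_1+2$. Then $\lambda$ is the height of $T$, $h$ (of degree $d+\lambda-2$) its apex, and $(\gamma_1,\dots,\gamma_r)$ its associated partition. In the notation of the claim $b_i=\gamma_i-2$. *)

theory Defs
  imports "HOL-Computational_Algebra.Computational_Algebra" "HOL-Library.Product_Plus"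
begin

section \<open>Binary forms and the operator \<open>\<partial>\<close>\<close>

text \<open>
  A polynomial in \<open>x, y\<close> over \<open>R\<close> is an element of \<open>R[x][y]\<close>, so the coefficient of
  \<open>x^i y^j\<close> in \<open>p\<close> is \<open>coeff (coeff p j) i\<close>.  The coefficient ring is kept general: besides
  \<open>R = \<complex>\<close> we use rings of functions on open subsets of \<open>\<P>^1\<close>, a form over such a ring
  being a section of \<open>S^d U \<otimes> \<O>\<close>.
\<close>

definition mon :: "nat \<Rightarrow> nat \<Rightarrow> 'a::comm_ring_1 poly poly" where
  "mon i j = monom (monom 1 i) j"

definition forms :: "nat \<Rightarrow> 'a::comm_ring_1 poly poly set" where
  "forms d = {p. \<forall>i j. coeff (coeff p j) i \<noteq> 0 \<longrightarrow> i + j = d}"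

definition scale2 :: "'a::comm_ring_1 \<Rightarrow> 'a poly poly \<Rightarrow> 'a poly poly" where
  "scale2 c p = smult [:c:] p"

interpretation cform: vector_space "scale2 :: complex \<Rightarrow> complex poly poly \<Rightarrow> complex poly poly"
  by unfold_locales
     (simp_all add: scale2_def smult_add_right smult_add_left[symmetric] mult.commute
        flip: one_pCons)

definition diff_x :: "complex poly poly \<Rightarrow> complex poly poly" where
  "diff_x p = map_poly pderiv p"

definition diff_y :: "complex poly poly \<Rightarrow> complex poly poly" where
  "diff_y p = pderiv p"

definition partial :: "complex poly poly set \<Rightarrow> complex poly poly set" where
  "partial W = cform.span (diff_x ` W \<union> diff_y ` W)"

definition internal_direct_sum ::
    "nat set \<Rightarrow> (nat \<Rightarrow> complex poly poly set) \<Rightarrow> complex poly poly set \<Rightarrow> bool" where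
  "internal_direct_sum I W T \<longleftrightarrow>
     (\<forall>i\<in>I. cform.subspace (W i)) \<and>
     T = cform.span (\<Union>i\<in>I. W i) \<and>
     (\<forall>i\<in>I. W i \<inter> cform.span (\<Union>j\<in>I - {i}. W j) = {0})"


section \<open>Special vector spaces\<close>

definition special ::
    "nat \<Rightarrow> nat \<Rightarrow> (nat \<Rightarrow> nat) \<Rightarrow> (nat \<Rightarrow> nat) \<Rightarrow> complex poly poly set \<Rightarrow> bool" where
  "special d r \<alpha> \<beta> T \<longleftrightarrow>
     2 \<le> r \<and> 2 \<le> \<alpha> 1 \<and>
     (\<forall>i\<in>{1..r}. \<alpha> i \<le> \<beta> i) \<and>
     (\<forall>i\<in>{1..r - 1}. \<alpha> (i + 1) = \<beta> i + 2) \<and>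
     \<beta> r + 2 \<le> d \<and>
     T = cform.span {mon (d - j) j | j. j \<in> (\<Union>i\<in>{1..r}. {\<alpha> i..\<beta> i})}"

definition part :: "(nat \<Rightarrow> nat) \<Rightarrow> (nat \<Rightarrow> nat) \<Rightarrow> nat \<Rightarrow> nat" where
  "part \<alpha> \<beta> i = \<beta> i - \<alpha> i + 2"

definition height :: "nat \<Rightarrow> (nat \<Rightarrow> nat) \<Rightarrow> (nat \<Rightarrow> nat) \<Rightarrow> nat" where
  "height r \<alpha> \<beta> = (\<Sum>i=1..r. part \<alpha> \<beta> i)"


section \<open>The Veronese embedding\<close>

text \<open>\<open>veronese d a b\<close> is \<open>(a x + b y)^d\<close>.\<close>

definition veronese :: "nat \<Rightarrow> 'a::comm_ring_1 \<Rightarrow> 'a \<Rightarrow> 'a poly poly" where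
  "veronese d a b = (scale2 a (mon 1 0) + scale2 b (mon 0 1)) ^ d"

text \<open>The punctured affine cone over the rational normal curve \<open>\<Gamma>\<^sub>d\<close>, for \<open>d \<ge> 1\<close>: it is
  closed under nonzero scalars because these are \<open>d\<close>-th powers.\<close>

definition rnc_cone :: "nat \<Rightarrow> complex poly poly set" where
  "rnc_cone d = {veronese d a b | a b. (a, b) \<noteq> (0, 0)}"


section \<open>The projective line\<close>

text \<open>
  The point \<open>[a x + b y]\<close> of \<open>\<P>^1 = \<P>(U)\<close> has the coordinate \<open>t = b / a\<close>.  \<open>U0\<close> is the
  affine open set \<open>a \<noteq> 0\<close>, \<open>U1\<close> is \<open>b \<noteq> 0\<close>, and \<open>U01\<close> is their intersection.  Their
  coordinate rings \<open>\<complex>[t]\<close>, \<open>\<complex>[t\<inverse>]\<close>, \<open>\<complex>[t, t\<inverse>]\<close> are taken inside the field of formal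
  Laurent series in \<open>t = fls_X\<close>, so that the restriction maps are inclusions.  A quasi-coherent
  sheaf is given by its modules of sections over \<open>U0\<close>, \<open>U1\<close>, \<open>U01\<close>.
\<close>

datatype p1_open = U0 | U1 | U01

fun regular :: "p1_open \<Rightarrow> complex fls set" where
  "regular U0 = {g. finite {n. fls_nth g n \<noteq> 0} \<and> (\<forall>n. fls_nth g n \<noteq> 0 \<longrightarrow> n \<ge> 0)}"
| "regular U1 = {g. finite {n. fls_nth g n \<noteq> 0} \<and> (\<forall>n. fls_nth g n \<noteq> 0 \<longrightarrow> n \<le> 0)}"
| "regular U01 = {g. finite {n. fls_nth g n \<noteq> 0}}"

text \<open>A generator of the tangent sheaf of \<open>\<P>^1\<close> over each of the open sets: \<open>d/dt\<close> on \<open>U0\<close> and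
  on \<open>U01\<close>, and \<open>d/dw = - t\<^sup>2 d/dt\<close> with \<open>w = t\<inverse>\<close> on \<open>U1\<close>.\<close>

fun vfield :: "p1_open \<Rightarrow> complex fls \<Rightarrow> complex fls" where
  "vfield U0 g = fls_deriv g"
| "vfield U1 g = - (fls_X ^ 2 * fls_deriv g)"
| "vfield U01 g = fls_deriv g"


section \<open>The normal sheaf of the rational curve of \<open>T\<close>\<close>

text \<open>
  Let \<open>V = S^d U / T\<close> and let \<open>f : \<P>^1 \<rightarrow> \<P>(V)\<close> be the rational curve of \<open>T\<close>.  The
  line subbundle \<open>f\<^sup>*\<O>(-1) \<subseteq> V \<otimes> \<O>\<close> has the local generator \<open>lift d W\<close> (modulo
  \<open>T \<otimes> \<O>\<close>): the Veronese map applied to the representative \<open>x + t y\<close>, respectively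
  \<open>t\<inverse> x + y\<close>, of the generic point.  Note \<open>lift d U1 = t^(-d) lift d U0\<close>.
\<close>

fun lift :: "nat \<Rightarrow> p1_open \<Rightarrow> complex fls poly poly" where
  "lift d U0 = veronese d 1 fls_X"
| "lift d U1 = veronese d (inverse fls_X) 1"
| "lift d U01 = veronese d 1 fls_X"

text \<open>Sections of \<open>S^d U \<otimes> \<O>\<close> over \<open>W\<close>.\<close>

definition form_sections :: "nat \<Rightarrow> p1_open \<Rightarrow> complex fls poly poly set" where
  "form_sections d W = {p \<in> forms d. \<forall>i j. coeff (coeff p j) i \<in> regular W}"

definition const_form :: "complex poly poly \<Rightarrow> complex fls poly poly" where
  "const_form p = map_poly (map_poly fls_const) p"

definition span_over ::
    "complex fls set \<Rightarrow> complex fls poly poly set \<Rightarrow> complex fls poly poly set" where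
  "span_over A S = {\<Sum>v\<in>F. scale2 (c v) v | F c. finite F \<and> F \<subseteq> S \<and> (\<forall>v\<in>F. c v \<in> A)}"

text \<open>
  The tangent sheaf of \<open>\<P>(V)\<close> is \<open>Hom(\<O>(-1), (V \<otimes> \<O>) / \<O>(-1))\<close>.  Hence, by evaluation at
  the generator \<open>lift d W\<close> of \<open>f\<^sup>*\<O>(-1)\<close>, the module of sections of \<open>f\<^sup>*T\<^bsub>\<P>(V)\<^esub>\<close> over \<open>W\<close> is
  \<open>form_sections d W\<close> modulo the following submodule.
\<close>

definition tangent_rel ::
    "nat \<Rightarrow> complex poly poly set \<Rightarrow> p1_open \<Rightarrow> complex fls poly poly set" where
  "tangent_rel d T W = span_over (regular W) (insert (lift d W) (const_form ` T))"

text \<open>The differential of \<open>f\<close> maps the vector field \<open>a \<partial>\<close>, where \<open>\<partial> = vfield W\<close>, to the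
  homomorphism sending \<open>lift d W\<close> to the class of \<open>a \<partial>(lift d W)\<close>.\<close>

definition differential :: "nat \<Rightarrow> p1_open \<Rightarrow> complex fls \<Rightarrow> complex fls poly poly" where
  "differential d W a = scale2 a (map_poly (map_poly (vfield W)) (lift d W))"

text \<open>The sections over \<open>W\<close> of the normal sheaf, the cokernel of the differential, are
  \<open>form_sections d W\<close> modulo the following submodule.\<close>

definition normal_rel ::
    "nat \<Rightarrow> complex poly poly set \<Rightarrow> p1_open \<Rightarrow> complex fls poly poly set" where
  "normal_rel d T W = {p + differential d W a | p a. p \<in> tangent_rel d T W \<and> a \<in> regular W}"

text \<open>
  A global section of the twist by \<open>\<O>(n)\<close> is a pair of sections over \<open>U0\<close> and \<open>U1\<close> that agree
  over \<open>U01\<close>.  In the trivialisations used here the transition functions are \<open>t^n\<close> for \<open>\<O>(n)\<close>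
  (whose generators are the \<open>n\<close>-th powers of the homogeneous coordinates) and \<open>t^d\<close> for evaluation
  at the two generators of \<open>f\<^sup>*\<O>(-1)\<close>.  The space of global sections is
  \<open>normal_cocycles\<close> modulo \<open>normal_null\<close>.
\<close>

definition normal_cocycles ::
    "nat \<Rightarrow> complex poly poly set \<Rightarrow> int
      \<Rightarrow> (complex fls poly poly \<times> complex fls poly poly) set" where
  "normal_cocycles d T n =
     {(p, q). p \<in> form_sections d U0 \<and> q \<in> form_sections d U1 \<and>
        p - scale2 (fls_X powi (int d + n)) q \<in> normal_rel d T U01}"

definition normal_null ::
    "nat \<Rightarrow> complex poly poly set \<Rightarrow> (complex fls poly poly \<times> complex fls poly poly) set" where
  "normal_null d T = normal_rel d T U0 \<times> normal_rel d T U1"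

text \<open>The dimension of \<open>Z / N\<close> for subspaces \<open>N \<subseteq> Z\<close>; as for the library's \<open>dim\<close>, the value
  is 0 if the dimension is infinite.\<close>

definition (in vector_space) quot_dim :: "'b set \<Rightarrow> 'b set \<Rightarrow> nat" where
  "quot_dim Z N = card (SOME B. B \<subseteq> Z \<and> Z \<subseteq> span (N \<union> B) \<and>
                                 (\<forall>b\<in>B. b \<notin> span (N \<union> (B - {b}))))"

definition pair_scale ::
    "complex \<Rightarrow> complex fls poly poly \<times> complex fls poly poly
      \<Rightarrow> complex fls poly poly \<times> complex fls poly poly" where
  "pair_scale c pq = (scale2 (fls_const c) (fst pq), scale2 (fls_const c) (snd pq))"

interpretation cpair: vector_space pair_scale
  by unfold_locales
     (simp_all add: pair_scale_def scale2_def smult_add_right smult_add_left[symmetric]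
        mult.commute fls_plus_const fls_const_mult_const flip: one_pCons)

definition h0_normal :: "nat \<Rightarrow> complex poly poly set \<Rightarrow> int \<Rightarrow> nat" where
  "h0_normal d T n = cpair.quot_dim (normal_cocycles d T n) (normal_null d T)"

definition phi :: "nat \<Rightarrow> complex poly poly set \<Rightarrow> int \<Rightarrow> int" where
  "phi d T k = int (h0_normal d T (- int d - 2 - k))"


section \<open>Notation of the formulas\<close>

definition second_diff :: "(int \<Rightarrow> int) \<Rightarrow> int \<Rightarrow> int" where
  "second_diff g k = g (k + 2) - 2 * g (k + 1) + g k"

definition pos_part :: "int \<Rightarrow> int" where
  "pos_part z = max 0 z"

definition kronecker :: "int \<Rightarrow> int \<Rightarrow> int" where
  "kronecker u v = (if u = v then 1 else 0)"

end

theory Submission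
  imports Defs
begin

text \<open>
  Projecting from a space spanned by monomials turns the rational normal curve into a monomial
  curve \<open>t \<mapsto> [t\<^bsup>\<kappa> 0\<^esup> : \<dots> : t\<^bsup>\<kappa> s\<^esup>]\<close>, and the normal bundle of such a curve splits as the
  sum of the line bundles \<open>\<O>(d + \<kappa> (i + 2) - \<kappa> i)\<close>.  To see this, divide the coefficient of
  \<open>x\<^bsup>d - j\<^esup> y\<^sup>j\<close> by \<open>(d choose j) t\<^sup>j\<close>.  Then the point of the curve and its derivative span the
  functions \<open>j \<mapsto> A + B j\<close>, so a section of \<open>S\<^sup>d U \<otimes> \<O>\<close> vanishes in the normal sheaf iff its second
  divided differences at consecutive nodes \<open>\<kappa> i, \<kappa> (i + 1), \<kappa> (i + 2)\<close> vanish.  The \<open>i\<close>-th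
  difference of a global section of the twist by \<open>\<O>(n)\<close> is a Laurent polynomial with exponents
  between \<open>- \<kappa> (i + 2)\<close> and \<open>d + n - \<kappa> i\<close>, and ramp functions with a kink at \<open>\<kappa> (i + 1)\<close> show that
  all of these occur.

  For a special \<open>T\<close> the gaps of \<open>\<kappa>\<close> are \<open>1, \<dots>, 1, \<gamma>\<^sub>1, \<dots>, \<gamma>\<^sub>r, 1, \<dots>, 1\<close>, and the sums of two
  consecutive gaps give the formula.
\<close>

section \<open>Dimension of a quotient by dual bases\<close>

context vector_space begin

text \<open>The functionals \<open>\<phi> i\<close> are coordinates on Z modulo N, and
  \<open>\<pi>\<close> is the resulting projection onto the span of the \<open>e i\<close>. Since
  \<open>quot_dim\<close> selects an arbitrary basis of Z modulo N, exhibiting one basis is not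
  enough: \<open>\<pi>\<close> carries every such basis injectively to a basis of that span, so all
  of them have size \<open>card I\<close>.\<close>

lemma quot_dim_eq_card:
  assumes Z: "subspace Z" and fin: "finite I"
    and add: "\<And>i v w. i \<in> I \<Longrightarrow> \<phi> i (v + w) = \<phi> i v + \<phi> i w"
    and scale: "\<And>i c v. i \<in> I \<Longrightarrow> \<phi> i (scale c v) = c * \<phi> i v"
    and null: "\<And>i v. i \<in> I \<Longrightarrow> v \<in> N \<Longrightarrow> \<phi> i v = 0"
    and ker: "\<And>v. v \<in> Z \<Longrightarrow> (\<And>i. i \<in> I \<Longrightarrow> \<phi> i v = 0) \<Longrightarrow> v \<in> N"
    and dual_in: "\<And>i. i \<in> I \<Longrightarrow> e i \<in> Z"
    and dual: "\<And>i j. i \<in> I \<Longrightarrow> j \<in> I \<Longrightarrow> \<phi> i (e j) = (if i = j then 1 else 0)"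
  shows "quot_dim Z N = card I"
proof -
  define \<pi> where "\<pi> v = (\<Sum>i\<in>I. scale (\<phi> i v) (e i))" for v
  have \<pi>_add: "\<pi> (v + w) = \<pi> v + \<pi> w" for v w
    by (simp add: \<pi>_def add scale_left_distrib sum.distrib)
  have \<pi>_scale: "\<pi> (scale c v) = scale c (\<pi> v)" for c v
    by (simp add: \<pi>_def scale scale_sum_right)
  interpret \<pi>: Vector_Spaces.linear scale scale \<pi>
    using \<pi>_add \<pi>_scale by unfold_locales auto
  have \<pi>_e: "\<pi> (e j) = e j" if "j \<in> I" for j
  proof -
    have "\<pi> (e j) = (\<Sum>i\<in>I. if i = j then e j else 0)"
      unfolding \<pi>_def using that by (intro sum.cong) (auto simp: dual)
    then show ?thesis using that fin by simp
  qed
  have \<phi>_\<pi>: "\<phi> i (\<pi> v) = \<phi> i v" if "i \<in> I" for i v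
  proof -
    have \<phi>0: "\<phi> i 0 = 0" using scale[OF that, of 0 0] by simp
    have "\<phi> i (\<Sum>j\<in>F. scale (\<phi> j v) (e j)) = (\<Sum>j\<in>F. \<phi> j v * \<phi> i (e j))" for F
      by (induction F rule: infinite_finite_induct) (simp_all add: \<phi>0 add scale that)
    also have "(\<Sum>j\<in>I. \<phi> j v * \<phi> i (e j)) = (\<Sum>j\<in>I. if i = j then \<phi> j v else 0)"
      using that by (intro sum.cong) (auto simp: dual)
    also have "\<dots> = \<phi> i v" using that fin by simp
    finally show ?thesis unfolding \<pi>_def .
  qed
  have \<pi>_N: "\<pi> v = 0" if "v \<in> N" for v
    using null that by (simp add: \<pi>_def)
  have \<pi>_Z: "\<pi> v \<in> Z" for v
    unfolding \<pi>_def using dual_in by (intro subspace_sum[OF Z] subspace_scale[OF Z])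
  have diff_N: "v - w \<in> N" if "v \<in> Z" "w \<in> Z" "\<pi> v = \<pi> w" for v w
  proof (rule ker)
    show "v - w \<in> Z" using that Z by (simp add: subspace_diff)
    fix i assume "i \<in> I"
    then show "\<phi> i (v - w) = 0"
      using \<phi>_\<pi>[of i "v - w"] \<phi>_\<pi>[of i 0] \<pi>.diff[of v w] that(3) scale[of i 0 0]
      by (simp add: \<pi>.zero)
  qed
  let ?P = "\<lambda>B. B \<subseteq> Z \<and> Z \<subseteq> span (N \<union> B) \<and> (\<forall>b\<in>B. b \<notin> span (N \<union> (B - {b})))"
  have inj_e: "inj_on e I"
  proof (rule inj_onI)
    fix i j assume "i \<in> I" "j \<in> I" "e i = e j"
    then have "(if i = j then 1 else 0) = (1::'a)" using dual[of i j] dual[of i i] by simp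
    then show "i = j" by (auto split: if_splits)
  qed
  \<comment> \<open>For \<open>b = e j\<close> the functional \<open>\<phi> j\<close> vanishes on
    the remaining vectors but is 1 on b.\<close>
  have indep_sub: "b \<notin> span (\<pi> ` (e ` I - {b}))" if b: "b \<in> e ` I" for b
  proof
    assume "b \<in> span (\<pi> ` (e ` I - {b}))"
    moreover obtain j where j: "j \<in> I" "b = e j" using b by blast
    moreover have "span (\<pi> ` (e ` I - {b})) \<subseteq> {v. \<phi> j v = 0}"
    proof (rule span_minimal)
      show "\<pi> ` (e ` I - {b}) \<subseteq> {v. \<phi> j v = 0}"
        using j by (auto simp: \<pi>_e dual)
      show "subspace {v. \<phi> j v = 0}"
        using j add scale scale[of j 0 0] by (auto simp: subspace_def)
    qed
    ultimately show False using dual[of j j] by auto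
  qed
  have "?P (e ` I)"
  proof (intro conjI ballI)
    show "e ` I \<subseteq> Z" using dual_in by auto
    show "Z \<subseteq> span (N \<union> e ` I)"
    proof
      fix v assume v: "v \<in> Z"
      have "\<pi> (\<pi> v) = \<pi> v" unfolding \<pi>_def[of v]
        by (subst \<pi>.sum) (simp add: \<pi>.scale \<pi>_e)
      then have "v - \<pi> v \<in> N" by (intro diff_N v \<pi>_Z) simp
      moreover have "\<pi> v \<in> span (N \<union> e ` I)"
        unfolding \<pi>_def by (intro span_sum span_scale span_base) auto
      ultimately have "(v - \<pi> v) + \<pi> v \<in> span (N \<union> e ` I)"
        by (intro span_add) (auto intro: span_base)
      then show "v \<in> span (N \<union> e ` I)" by simp
    qed
    fix b assume b: "b \<in> e ` I"
    show "b \<notin> span (N \<union> (e ` I - {b}))"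
    proof
      assume "b \<in> span (N \<union> (e ` I - {b}))"
      then have "\<pi> b \<in> span (\<pi> ` (N \<union> (e ` I - {b})))"
        unfolding \<pi>.span_image by blast
      moreover have "span (\<pi> ` (N \<union> (e ` I - {b}))) \<subseteq> span (\<pi> ` (e ` I - {b}))"
        using \<pi>_N by (intro span_minimal subspace_span) (auto intro: span_base span_zero)
      ultimately show False using indep_sub[OF b] b by (auto simp: \<pi>_e)
    qed
  qed
  moreover have "card B = card I" if B: "?P B" for B
  proof -
    have sub: "span B \<subseteq> Z" using B Z by (intro span_minimal) auto
    \<comment> \<open>A relation among the images under \<open>\<pi>\<close> lifts to a relation
      modulo N, because N contains the kernel of \<open>\<pi>\<close> on Z.\<close>
    have new: "\<pi> b \<notin> span (\<pi> ` (B - {b}))" if b: "b \<in> B" for b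
    proof
      assume "\<pi> b \<in> span (\<pi> ` (B - {b}))"
      then obtain v where v: "v \<in> span (B - {b})" "\<pi> b = \<pi> v"
        unfolding \<pi>.span_image by blast
      have "span (B - {b}) \<subseteq> span B" by (intro span_mono) auto
      then have "b - v \<in> N" using v sub B b by (intro diff_N) auto
      moreover have "span (B - {b}) \<subseteq> span (N \<union> (B - {b}))" by (intro span_mono) auto
      ultimately have "(b - v) + v \<in> span (N \<union> (B - {b}))"
        using v by (intro span_add) (auto intro: span_base)
      then show False using B b by simp
    qed
    have inj: "inj_on \<pi> B"
    proof (rule inj_onI, rule ccontr)
      fix b c assume "b \<in> B" "c \<in> B" "\<pi> b = \<pi> c" "b \<noteq> c"
      then show False using new[of b] span_base[of "\<pi> c" "\<pi> ` (B - {b})"] by auto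
    qed
    have "independent (\<pi> ` B)"
      unfolding dependent_def
    proof (safe)
      fix b assume b: "b \<in> B" and "\<pi> b \<in> span (\<pi> ` B - {\<pi> b})"
      moreover have "\<pi> ` B - {\<pi> b} \<subseteq> \<pi> ` (B - {b})" by auto
      ultimately show False using new[OF b] span_mono by blast
    qed
    moreover have "span (\<pi> ` B) = span (e ` I)"
    proof
      have "\<pi> v \<in> span (e ` I)" for v
        unfolding \<pi>_def by (intro span_sum span_scale span_base) auto
      then show "span (\<pi> ` B) \<subseteq> span (e ` I)"
        by (intro span_minimal subspace_span) auto
      show "span (e ` I) \<subseteq> span (\<pi> ` B)"
      proof (intro span_minimal subspace_span subsetI)
        fix x assume x: "x \<in> e ` I"
        then have "x \<in> span (N \<union> B)" using B dual_in by auto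
        then have "\<pi> x \<in> span (\<pi> ` (N \<union> B))" unfolding \<pi>.span_image by blast
        moreover have "span (\<pi> ` (N \<union> B)) \<subseteq> span (\<pi> ` B)"
          using \<pi>_N by (intro span_minimal subspace_span) (auto intro: span_base span_zero)
        ultimately show "x \<in> span (\<pi> ` B)" using x by (auto simp: \<pi>_e)
      qed
    qed
    moreover have "independent (e ` I)"
      unfolding dependent_def
    proof (safe)
      fix i assume "i \<in> I" "e i \<in> span (e ` I - {e i})"
      moreover have "\<pi> ` (e ` I - {e i}) = e ` I - {e i}" by (force simp: \<pi>_e)
      ultimately show False using indep_sub[of "e i"] by auto
    qed
    ultimately have "card (\<pi> ` B) = card (e ` I)"
      by (metis dim_eq_card)
    then show ?thesis using inj inj_e by (simp add: card_image)
  qed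
  ultimately show ?thesis
    unfolding quot_dim_def by (rule someI2[where Q = "\<lambda>B. card B = card I"])
qed

end

section \<open>Binary forms and regular functions\<close>

definition form_of :: "nat \<Rightarrow> (nat \<Rightarrow> 'a::comm_ring_1) \<Rightarrow> 'a poly poly" where
  "form_of d c = (\<Sum>j\<le>d. monom (monom (c j) (d - j)) j)"

definition form_coeff :: "nat \<Rightarrow> 'a::comm_ring_1 poly poly \<Rightarrow> nat \<Rightarrow> 'a" where
  "form_coeff d p j = coeff (coeff p j) (d - j)"

lemma coeff_form_of: "coeff (coeff (form_of d c) j) i = (if i + j = d then c j else 0)"
proof -
  have "coeff (coeff (form_of d c) j) i = (\<Sum>k\<le>d. if k = j then (if i + j = d then c j else 0) else 0)"
    unfolding form_of_def coeff_sum by (intro sum.cong) auto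
  then show ?thesis by auto
qed

lemma form_coeff_form_of: "j \<le> d \<Longrightarrow> form_coeff d (form_of d c) j = c j"
  by (simp add: form_coeff_def coeff_form_of)

lemma form_of_form_coeff:
  assumes "p \<in> forms d"
  shows "form_of d (form_coeff d p) = p"
proof (intro poly_eqI)
  fix i j
  show "coeff (coeff (form_of d (form_coeff d p)) i) j = coeff (coeff p i) j"
    using assms by (cases "j + i = d") (auto simp: coeff_form_of form_coeff_def forms_def)
qed

lemma form_coeff_add: "form_coeff d (p + q) j = form_coeff d p j + form_coeff d q j"
  and form_coeff_diff: "form_coeff d (p - q) j = form_coeff d p j - form_coeff d q j"
  and form_coeff_scale2: "form_coeff d (scale2 a p) j = a * form_coeff d p j"
  by (simp_all add: form_coeff_def scale2_def)

lemma scale2_form_of: "scale2 a (form_of d c) = form_of d (\<lambda>j. a * c j)"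
  by (intro poly_eqI) (simp add: coeff_form_of scale2_def)

lemma map_poly_form_of:
  assumes "f 0 = 0"
  shows "map_poly (map_poly f) (form_of d c) = form_of d (\<lambda>j. f (c j))"
  by (intro poly_eqI) (simp add: coeff_form_of coeff_map_poly assms)

lemma veronese_eq_form_of:
  "veronese d a b = form_of d (\<lambda>j. of_nat (d choose j) * a ^ (d - j) * b ^ j)"
proof -
  have x: "scale2 a (mon 1 0) = monom (monom a 1) 0" and y: "scale2 b (mon 0 1) = monom (monom b 0) 1"
    by (simp_all add: scale2_def mon_def smult_monom monom_0 mult.commute)
  \<comment> \<open>The summands are swapped because \<open>binomial_ring\<close> puts the exponent
    k on the first one, and k has to be the exponent of y.\<close>
  have "veronese d a b = (scale2 b (mon 0 1) + scale2 a (mon 1 0)) ^ d"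
    unfolding veronese_def by (simp add: add.commute)
  also have "\<dots> = (\<Sum>k\<le>d. of_nat (d choose k) * monom (monom b 0) 1 ^ k * monom (monom a 1) 0 ^ (d - k))"
    unfolding x y by (rule binomial_ring)
  also have "\<dots> = form_of d (\<lambda>j. of_nat (d choose j) * a ^ (d - j) * b ^ j)"
    unfolding form_of_def
    by (intro sum.cong refl)
       (simp add: monom_power mult_monom mult.assoc of_nat_poly mult.commute flip: monom_0)
  finally show ?thesis .
qed

lemma const_form_mon: "const_form (mon i j) = mon i j"
  by (simp add: const_form_def mon_def map_poly_monom)

section \<open>Laurent monomials, kept in the form \<open>fls_X powi n\<close>, and the rings of
  regular functions\<close>

declare fls_X_power_int [simp del] power_int_minus1_right [simp del] power_int_of_nat [simp del]

lemma fls_X_powi_times_nth: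
  "fls_nth (fls_X powi n * f) i = fls_nth f (i - n)" for f :: "'a::field fls"
  by (simp add: fls_X_power_int fls_X_intpow_times_conv_shift)

lemma fls_X_powi_nth: "fls_nth (fls_X powi n :: 'a::field fls) i = (if i = n then 1 else 0)"
  using fls_X_powi_times_nth[of n 1 i] by simp

lemma fls_deriv_X_powi:
  "fls_deriv (fls_X powi n :: 'a::field fls) = of_int n * fls_X powi (n - 1)"
proof (intro fls_eqI)
  fix i
  have "of_int i + 1 = (of_int (i + 1) :: 'a)" by simp
  then show "fls_nth (fls_deriv (fls_X powi n :: 'a fls)) i = fls_nth (of_int n * fls_X powi (n - 1)) i"
    by (cases "i + 1 = n") (auto simp: fls_X_powi_nth fls_of_int simp del: of_int_add)
qed

lemma zero_in_regular: "0 \<in> regular W"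
  by (cases W) auto

lemma regular_add: "f \<in> regular W \<Longrightarrow> g \<in> regular W \<Longrightarrow> f + g \<in> regular W"
proof -
  have "{n. fls_nth f n + fls_nth g n \<noteq> 0} \<subseteq> {n. fls_nth f n \<noteq> 0} \<union> {n. fls_nth g n \<noteq> 0}" by auto
  then have "finite {n. fls_nth f n \<noteq> 0} \<Longrightarrow> finite {n. fls_nth g n \<noteq> 0}
      \<Longrightarrow> finite {n. fls_nth f n + fls_nth g n \<noteq> 0}"
    by (meson finite_UnI finite_subset)
  then show "f \<in> regular W \<Longrightarrow> g \<in> regular W \<Longrightarrow> f + g \<in> regular W"
    by (cases W) (auto, (metis add_0)+)
qed

lemma regular_const_mult: "f \<in> regular W \<Longrightarrow> fls_const c * f \<in> regular W"
proof -
  have "{n. c \<noteq> 0 \<and> fls_nth f n \<noteq> 0} \<subseteq> {n. fls_nth f n \<noteq> 0}" by auto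
  then have "finite {n. fls_nth f n \<noteq> 0} \<Longrightarrow> finite {n. c \<noteq> 0 \<and> fls_nth f n \<noteq> 0}"
    by (meson finite_subset)
  then show "f \<in> regular W \<Longrightarrow> fls_const c * f \<in> regular W"
    by (cases W) (auto simp: fls_mult_const_nth)
qed

lemma regular_diff: "f \<in> regular W \<Longrightarrow> g \<in> regular W \<Longrightarrow> f - g \<in> regular W"
  using regular_add[of f W "fls_const (- 1) * g"] regular_const_mult[of g W "- 1"] by simp

lemma regular_of_nat_mult: "f \<in> regular W \<Longrightarrow> of_nat n * f \<in> regular W"
  by (simp add: fls_of_nat regular_const_mult)

lemma regular_divide_of_nat: "f \<in> regular W \<Longrightarrow> f / of_nat n \<in> regular W"
  using regular_const_mult[of f W "inverse (of_nat n)"]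
  by (simp only: fls_of_nat fls_inverse_const[symmetric] divide_inverse mult.commute)

lemma regular_X_powi_mult:
  assumes "f \<in> regular W" "W = U0 \<Longrightarrow> n \<ge> 0" "W = U1 \<Longrightarrow> n \<le> 0"
  shows "fls_X powi n * f \<in> regular W"
proof -
  have "{i. fls_nth f (i - n) \<noteq> 0} = (\<lambda>i. i + n) ` {i. fls_nth f i \<noteq> 0}"
    by (auto simp: image_iff intro!: exI[of _ "x - n" for x])
  then have "finite {i. fls_nth f i \<noteq> 0} \<Longrightarrow> finite {i. fls_nth f (i - n) \<noteq> 0}"
    by simp
  moreover have "0 \<le> i" if "W = U0" "fls_nth f (i - n) \<noteq> 0" for i
    using assms(1,2) that by fastforce
  moreover have "i \<le> 0" if "W = U1" "fls_nth f (i - n) \<noteq> 0" for i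
    using assms(1,3) that by fastforce
  ultimately show ?thesis
    using assms(1) by (cases W) (auto simp: fls_X_powi_times_nth)
qed

lemma one_in_regular: "1 \<in> regular W"
proof -
  have "{n. fls_nth (1 :: complex fls) n \<noteq> 0} \<subseteq> {0}" by auto
  then have "finite {n. fls_nth (1 :: complex fls) n \<noteq> 0}" by (rule finite_subset) simp
  then show ?thesis by (cases W) auto
qed

lemma form_of_in_form_sections:
  "(\<And>j. j \<le> d \<Longrightarrow> c j \<in> regular W) \<Longrightarrow> form_of d c \<in> form_sections d W"
  unfolding form_sections_def forms_def by (auto simp: coeff_form_of zero_in_regular)

lemma form_coeff_in_regular: "p \<in> form_sections d W \<Longrightarrow> form_coeff d p j \<in> regular W"
  by (simp add: form_sections_def form_coeff_def)

section \<open>The normal sheaf of a monomial curve\<close>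

lemma form_of_cong: "(\<And>j. j \<le> d \<Longrightarrow> c j = c' j) \<Longrightarrow> form_of d c = form_of d c'"
  unfolding form_of_def by (intro sum.cong) auto

text \<open>The \<open>d\<close>-th power of the generic linear form has constant weight, and its derivative along
  \<open>\<P>\<^sup>1\<close> has weight a multiple of \<open>j\<close>; this is the point of the normalisation.\<close>

definition weight :: "nat \<Rightarrow> complex fls poly poly \<Rightarrow> nat \<Rightarrow> complex fls" where
  "weight d p j = fls_X powi (- int j) * (form_coeff d p j / of_nat (d choose j))"

lemma weight_add: "weight d (p + q) j = weight d p j + weight d q j"
  and weight_diff: "weight d (p - q) j = weight d p j - weight d q j"
  and weight_scale2: "weight d (scale2 a p) j = a * weight d p j"
  by (simp_all add: weight_def form_coeff_add form_coeff_diff form_coeff_scale2 algebra_simps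
      add_divide_distrib diff_divide_distrib)

lemma form_coeff_eq_weight:
  assumes "j \<le> d"
  shows "form_coeff d p j = of_nat (d choose j) * (fls_X powi int j * weight d p j)"
proof -
  have "(of_nat (d choose j) :: complex fls) \<noteq> 0" using assms by simp
  then show ?thesis by (simp add: weight_def power_int_minus)
qed

lemma weight_form_of:
  assumes "j \<le> d"
  shows "weight d (form_of d (\<lambda>j. of_nat (d choose j) * (fls_X powi int j * u j))) j = u j"
proof -
  have "(of_nat (d choose j) :: complex fls) \<noteq> 0" using assms by simp
  then show ?thesis using assms by (simp add: weight_def power_int_minus form_coeff_form_of)
qed

text \<open>By the two lemmas \<open>weight_lift\<close> and \<open>weight_differential\<close> below, \<open>twist\<close> and \<open>slope\<close> are the
  weights of the generator of \<open>f\<^sup>*\<O>(-1)\<close> and of its derivative.\<close>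

fun twist :: "nat \<Rightarrow> p1_open \<Rightarrow> int" where
  "twist d U0 = 0" | "twist d U1 = - int d" | "twist d U01 = 0"

fun slope :: "nat \<Rightarrow> p1_open \<Rightarrow> nat \<Rightarrow> complex fls" where
  "slope d U0 j = fls_X powi (- 1) * of_int (int j)"
| "slope d U1 j = fls_X powi (1 - int d) * of_int (int d - int j)"
| "slope d U01 j = fls_X powi (- 1) * of_int (int j)"

text \<open>Dividing x + t y by t divides its d-th power by t^d; this is the \<open>twist\<close> on
  \<open>U1\<close>.\<close>

lemma lift_eq_form_of:
  "lift d W = form_of d (\<lambda>j. of_nat (d choose j) * (fls_X powi int j * fls_X powi twist d W))"
proof (cases W)
  case U1
  have *: "inverse fls_X ^ (d - j) = (fls_X powi int j * fls_X powi (- int d) :: complex fls)"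
    if "j \<le> d" for j
  proof -
    have "inverse fls_X ^ (d - j) = (fls_X powi (- int (d - j)) :: complex fls)"
      by (simp only: power_int_minus power_int_of_nat power_inverse)
    also have "- int (d - j) = int j + (- int d)" using that by simp
    finally show ?thesis by (subst (asm) power_int_add) auto
  qed
  show ?thesis unfolding U1 lift.simps twist.simps veronese_eq_form_of
    by (intro form_of_cong) (simp only: * power_one mult_1_right mult.assoc)
qed (auto simp: veronese_eq_form_of power_int_of_nat)

text \<open>The field d/dt multiplies t^j by j / t, and on \<open>U1\<close> the field -t^2 d/dt
  multiplies t^(j - d) by (d - j) t. Both factors are affine in j.\<close>

lemma differential_eq_form_of:
  "differential d W a = form_of d (\<lambda>j. of_nat (d choose j) * (fls_X powi int j * (a * slope d W j)))"
proof -
  have vfield0: "vfield W 0 = 0" by (cases W) auto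
  have dX: "fls_deriv (of_nat k * fls_X powi n :: complex fls)
      = of_nat k * (of_int n * fls_X powi (n - 1))" for k n
    by (simp add: fls_deriv_X_powi)
  have merge: "fls_X powi int j * fls_X powi i = (fls_X powi (int j + i) :: complex fls)" for i j
    by (simp add: power_int_add)
  have key: "a * vfield W (of_nat (d choose j) * (fls_X powi int j * fls_X powi twist d W))
      = of_nat (d choose j) * (fls_X powi int j * (a * slope d W j))" for j
  proof (cases W)
    case U1
    have "fls_X ^ 2 * fls_X powi (int j - int d - 1)
        = (fls_X powi int j * fls_X powi (1 - int d) :: complex fls)"
      using power_int_add[of "fls_X :: complex fls" 2 "int j - int d - 1"]
      by (simp add: merge algebra_simps)
    then have *: "fls_X ^ 2 * (c * fls_X powi (int j - int d - 1))
        = c * (fls_X powi int j * fls_X powi (1 - int d) :: complex fls)" for c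
      by (simp only: mult.left_commute)
    have "vfield U1 (of_nat (d choose j) * fls_X powi (int j - int d))
        = of_nat (d choose j) * ((of_nat d - of_nat j) * (fls_X powi int j * fls_X powi (1 - int d)))"
      unfolding vfield.simps dX mult.left_commute[of "fls_X ^ 2" "of_nat (d choose j)"] *
      by (simp add: algebra_simps)
    moreover have "fls_X powi int j * fls_X powi twist d U1
        = (fls_X powi (int j - int d) :: complex fls)"
      by (simp add: merge)
    ultimately show ?thesis unfolding U1 by (simp only:) (simp add: mult_ac)
  next
    case U0
    then show ?thesis using merge[of j "- 1"] dX[of "d choose j" "int j"] by (simp add: algebra_simps)
  next
    case U01
    then show ?thesis using merge[of j "- 1"] dX[of "d choose j" "int j"] by (simp add: algebra_simps)
  qed
  then show ?thesis
    unfolding differential_def lift_eq_form_of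
    by (simp only: map_poly_form_of[where f = "vfield W", OF vfield0] scale2_form_of key)
qed

lemma weight_lift: "j \<le> d \<Longrightarrow> weight d (lift d W) j = fls_X powi twist d W"
  by (simp only: lift_eq_form_of weight_form_of)

lemma weight_differential: "j \<le> d \<Longrightarrow> weight d (differential d W a) j = a * slope d W j"
  by (simp only: differential_eq_form_of weight_form_of)

lemma form_sections_diff:
  "p \<in> form_sections d W \<Longrightarrow> q \<in> form_sections d W \<Longrightarrow> p - q \<in> form_sections d W"
  unfolding form_sections_def forms_def
  by (auto simp: regular_diff) (metis diff_zero)

lemma form_sections_add:
  "p \<in> form_sections d W \<Longrightarrow> q \<in> form_sections d W \<Longrightarrow> p + q \<in> form_sections d W"
  unfolding form_sections_def forms_def
  by (auto simp: regular_add) (metis add_0)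

lemma scale2_lift_in_form_sections:
  assumes "a \<in> regular W"
  shows "scale2 a (lift d W) \<in> form_sections d W"
  unfolding lift_eq_form_of scale2_form_of
proof (rule form_of_in_form_sections)
  fix j assume "j \<le> d"
  then have "of_nat (d choose j) * (fls_X powi (int j + twist d W) * a) \<in> regular W"
    by (intro regular_of_nat_mult regular_X_powi_mult assms) auto
  then show "a * (of_nat (d choose j) * (fls_X powi int j * fls_X powi twist d W)) \<in> regular W"
    by (subst (asm) power_int_add) (simp_all add: mult_ac)
qed

lemma differential_in_form_sections:
  assumes "a \<in> regular W"
  shows "differential d W a \<in> form_sections d W"
  unfolding differential_eq_form_of
proof (intro form_of_in_form_sections regular_of_nat_mult)
  fix j assume j: "j \<le> d"
  \<comment> \<open>The slope brings in t^(j - 1), respectively t^(j + 1 - d) on \<open>U1\<close>.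
    The power leaves the ring only at j = 0 on \<open>U0\<close> and at j = d on \<open>U1\<close>,
    where the factor j, respectively d - j, is zero.\<close>
  show "fls_X powi int j * (a * slope d W j) \<in> regular W"
  proof (cases "slope d W j = 0")
    case True
    then show ?thesis by (simp add: zero_in_regular)
  next
    case False
    define k where "k = (if W = U1 then d - j else j)"
    define n where "n = (if W = U1 then int j + 1 - int d else int j - 1)"
    have "fls_X powi int j * (a * slope d W j) = of_nat k * (fls_X powi n * a)"
    proof (cases W)
      case U1
      have "fls_X powi (int j + 1 - int d) = (fls_X powi int j * fls_X powi (1 - int d) :: complex fls)"
        using power_int_add[of "fls_X :: complex fls" "int j" "1 - int d"] by (simp add: algebra_simps)
      then show ?thesis using U1 j by (simp add: k_def n_def of_nat_diff)
    next
      case U0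
      then show ?thesis
        using power_int_add[of "fls_X :: complex fls" "int j" "- 1"] by (simp add: k_def n_def)
    next
      case U01
      then show ?thesis
        using power_int_add[of "fls_X :: complex fls" "int j" "- 1"] by (simp add: k_def n_def)
    qed
    moreover have "of_nat k * (fls_X powi n * a) \<in> regular W"
      using False j by (intro regular_of_nat_mult regular_X_powi_mult assms) (auto simp: n_def)
    ultimately show ?thesis by metis
  qed
qed

section \<open>Linear combinations over a ring of functions\<close>

lemma span_over_add:
  assumes add: "\<And>a b. a \<in> A \<Longrightarrow> b \<in> A \<Longrightarrow> a + b \<in> A" and zero: "0 \<in> A"
    and "p \<in> span_over A S" "q \<in> span_over A S"
  shows "p + q \<in> span_over A S"
proof -
  obtain F c where F: "p = (\<Sum>v\<in>F. scale2 (c v) v)" "finite F" "F \<subseteq> S" "\<forall>v\<in>F. c v \<in> A"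
    using assms(3) unfolding span_over_def by blast
  obtain G e where G: "q = (\<Sum>v\<in>G. scale2 (e v) v)" "finite G" "G \<subseteq> S" "\<forall>v\<in>G. e v \<in> A"
    using assms(4) unfolding span_over_def by blast
  define h where "h v = (if v \<in> F then c v else 0) + (if v \<in> G then e v else 0)" for v
  have "p = (\<Sum>v\<in>F \<union> G. scale2 (if v \<in> F then c v else 0) v)"
    unfolding F(1) using F(2) G(2) by (intro sum.mono_neutral_cong_left) (auto simp: scale2_def)
  moreover have "q = (\<Sum>v\<in>F \<union> G. scale2 (if v \<in> G then e v else 0) v)"
    unfolding G(1) using F(2) G(2) by (intro sum.mono_neutral_cong_left) (auto simp: scale2_def)
  ultimately have "p + q = (\<Sum>v\<in>F \<union> G. scale2 (h v) v)"
    by (simp add: h_def scale2_def smult_add_left[symmetric] flip: sum.distrib)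
  moreover have "\<forall>v\<in>F \<union> G. h v \<in> A" using F(4) G(4) add zero by (auto simp: h_def)
  ultimately show ?thesis using F(2,3) G(2,3) unfolding span_over_def by blast
qed

lemma scale2_in_span_over: "a \<in> A \<Longrightarrow> v \<in> S \<Longrightarrow> scale2 a v \<in> span_over A S"
  unfolding span_over_def by (rule CollectI, rule exI[of _ "{v}"], rule exI[of _ "\<lambda>_. a"]) simp

lemma zero_in_span_over: "0 \<in> span_over A S"
  unfolding span_over_def by (rule CollectI, rule exI[of _ "{}"]) simp

lemma sum_in_span_over:
  assumes "\<And>a b. a \<in> A \<Longrightarrow> b \<in> A \<Longrightarrow> a + b \<in> A" "0 \<in> A"
    and "\<And>i. i \<in> I \<Longrightarrow> g i \<in> span_over A S"
  shows "(\<Sum>i\<in>I. g i) \<in> span_over A S"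
  using assms(3)
  by (induction I rule: infinite_finite_induct)
     (auto intro: span_over_add[OF assms(1,2)] zero_in_span_over)

text \<open>The curve \<open>t \<mapsto> [t\<^bsup>\<kappa> 0\<^esup> : \<dots> : t\<^bsup>\<kappa> (N + 1)\<^esup>]\<close>, whose normal bundle has rank \<open>N\<close>.  The
  conditions on the first and last two exponents make it an immersion at \<open>0\<close> and \<open>\<infinity>\<close>.\<close>

locale monomial_curve =
  fixes d N :: nat and \<kappa> :: "nat \<Rightarrow> nat" and T :: "complex poly poly set"
  assumes step: "i \<le> N \<Longrightarrow> \<kappa> i < \<kappa> (Suc i)"
    and ends: "\<kappa> 0 = 0" "\<kappa> 1 = 1" "Suc (\<kappa> N) = d" "\<kappa> (Suc N) = d"
    and T_eq: "T = cform.span {mon (d - j) j | j. j \<le> d \<and> j \<notin> \<kappa> ` {..Suc N}}"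
begin

lemma mono: "i \<le> j \<Longrightarrow> j \<le> Suc N \<Longrightarrow> \<kappa> i \<le> \<kappa> j"
  by (induction j rule: dec_induct) (auto dest: step)

lemma le_d: "i \<le> Suc N \<Longrightarrow> \<kappa> i \<le> d"
  using mono[of i "Suc N"] ends by simp

text \<open>A and B may be arbitrary Laurent series. That they automatically come from regular
  coefficients of \<open>lift\<close> and of its derivative is the content of
  \<open>normal_rel_iff_affine\<close>.\<close>

definition affine :: "complex fls poly poly \<Rightarrow> bool" where
  "affine p \<longleftrightarrow> (\<exists>A B. \<forall>i\<le>Suc N. weight d p (\<kappa> i) = A + B * of_nat (\<kappa> i))"

lemma affine_add:
  assumes "affine p" "affine q"
  shows "affine (p + q)"
proof -
  obtain A B A' B' where "\<forall>i\<le>Suc N. weight d p (\<kappa> i) = A + B * of_nat (\<kappa> i)"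
    "\<forall>i\<le>Suc N. weight d q (\<kappa> i) = A' + B' * of_nat (\<kappa> i)"
    using assms unfolding affine_def by blast
  then have "\<forall>i\<le>Suc N. weight d (p + q) (\<kappa> i) = (A + A') + (B + B') * of_nat (\<kappa> i)"
    by (simp add: weight_add algebra_simps)
  then show ?thesis unfolding affine_def by blast
qed

lemma affine_scale2:
  assumes "affine p"
  shows "affine (scale2 a p)"
proof -
  obtain A B where "\<forall>i\<le>Suc N. weight d p (\<kappa> i) = A + B * of_nat (\<kappa> i)"
    using assms unfolding affine_def by blast
  then have "\<forall>i\<le>Suc N. weight d (scale2 a p) (\<kappa> i) = (a * A) + (a * B) * of_nat (\<kappa> i)"
    by (simp add: weight_scale2 algebra_simps)
  then show ?thesis unfolding affine_def by blast
qed

lemma affine_zero: "affine 0"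
  unfolding affine_def by (rule exI[of _ 0])+ (simp add: weight_def form_coeff_def)

lemma affine_lift: "affine (lift d W)"
  unfolding affine_def by (rule exI[of _ "fls_X powi twist d W"], rule exI[of _ 0])
    (simp add: weight_lift le_d)

lemma affine_differential: "affine (differential d W a)"
proof (cases W)
  case U1
  have "weight d (differential d W a) (\<kappa> i)
      = a * fls_X powi (1 - int d) * of_nat d + (- a * fls_X powi (1 - int d)) * of_nat (\<kappa> i)"
    if "i \<le> Suc N" for i
    using that U1 by (simp add: weight_differential le_d algebra_simps)
  then show ?thesis unfolding affine_def by blast
next
  case U0
  have "weight d (differential d W a) (\<kappa> i) = 0 + (a * fls_X powi (- 1)) * of_nat (\<kappa> i)"
    if "i \<le> Suc N" for i
    using that U0 by (simp add: weight_differential le_d algebra_simps)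
  then show ?thesis unfolding affine_def by blast
next
  case U01
  have "weight d (differential d W a) (\<kappa> i) = 0 + (a * fls_X powi (- 1)) * of_nat (\<kappa> i)"
    if "i \<le> Suc N" for i
    using that U01 by (simp add: weight_differential le_d algebra_simps)
  then show ?thesis unfolding affine_def by blast
qed

lemma coeff_T:
  assumes "p \<in> T" "i \<le> Suc N"
  shows "coeff (coeff p (\<kappa> i)) n = 0"
proof -
  have "{mon (d - j) j | j. j \<le> d \<and> j \<notin> \<kappa> ` {..Suc N}} \<subseteq> {p. coeff (coeff p (\<kappa> i)) n = 0}"
    using assms(2) by (auto simp: mon_def)
  moreover have "cform.subspace {p. coeff (coeff p (\<kappa> i)) n = 0}"
    by (auto simp: cform.subspace_def scale2_def)
  ultimately have "T \<subseteq> {p. coeff (coeff p (\<kappa> i)) n = 0}"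
    unfolding T_eq by (rule cform.span_minimal)
  then show ?thesis using assms(1) by auto
qed

lemma affine_const_form: "p \<in> T \<Longrightarrow> affine (const_form p)"
  unfolding affine_def
  by (rule exI[of _ 0])+ (simp add: weight_def form_coeff_def const_form_def coeff_map_poly coeff_T)

lemma affine_normal_rel:
  assumes "p \<in> normal_rel d T W"
  shows "affine p"
proof -
  obtain t a where p: "p = t + differential d W a" "t \<in> tangent_rel d T W"
    using assms unfolding normal_rel_def by blast
  obtain F c where F: "t = (\<Sum>v\<in>F. scale2 (c v) v)" "F \<subseteq> insert (lift d W) (const_form ` T)"
    using p(2) unfolding tangent_rel_def span_over_def by blast
  have "affine (scale2 (c v) v)" if "v \<in> F" for v
    using that F(2) affine_lift affine_const_form by (intro affine_scale2) auto
  then have "affine (\<Sum>v\<in>F. scale2 (c v) v)"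
    by (induction F rule: infinite_finite_induct) (auto intro: affine_zero affine_add)
  then show ?thesis using p F(1) affine_add affine_differential by simp
qed

text \<open>Subtracting the multiples of \<open>lift\<close> and of its derivative kills the
  coefficients at all nodes; the remainder is a combination, with regular coefficients, of monomials
  in T.\<close>

lemma in_normal_rel:
  assumes p: "p \<in> form_sections d W" and a: "a \<in> regular W" and b: "b \<in> regular W"
    and eq: "\<And>i. i \<le> Suc N \<Longrightarrow> weight d p (\<kappa> i) = a * fls_X powi twist d W + b * slope d W (\<kappa> i)"
  shows "p \<in> normal_rel d T W"
proof -
  define q where "q = p - scale2 a (lift d W) - differential d W b"
  have q: "q \<in> form_sections d W" unfolding q_def
    using p a b by (intro form_sections_diff scale2_lift_in_form_sections differential_in_form_sections)
  let ?J = "{j. j \<le> d \<and> j \<notin> \<kappa> ` {..Suc N}}"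
  have q0: "form_coeff d q j = 0" if "j \<le> d" "j \<notin> ?J" for j
  proof -
    have "j \<in> \<kappa> ` {..Suc N}" using that by simp
    then obtain i where i: "i \<le> Suc N" "j = \<kappa> i" by blast
    have "weight d q j = 0"
      using i by (simp add: q_def weight_diff weight_scale2 weight_lift weight_differential eq le_d)
    then show ?thesis using that by (simp add: form_coeff_eq_weight)
  qed
  have "q = form_of d (form_coeff d q)"
    using q by (simp add: form_of_form_coeff form_sections_def)
  also have "\<dots> = (\<Sum>j\<le>d. scale2 (form_coeff d q j) (mon (d - j) j))"
    unfolding form_of_def by (simp add: scale2_def mon_def smult_monom)
  also have "\<dots> = (\<Sum>j\<in>?J. scale2 (form_coeff d q j) (mon (d - j) j))"
    using q0 by (intro sum.mono_neutral_right) (auto simp: scale2_def)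
  also have "\<dots> \<in> tangent_rel d T W"
    unfolding tangent_rel_def
  proof (intro sum_in_span_over scale2_in_span_over regular_add zero_in_regular)
    fix j assume j: "j \<in> ?J"
    show "form_coeff d q j \<in> regular W" by (rule form_coeff_in_regular[OF q])
    have "mon (d - j) j \<in> T" unfolding T_eq using j by (intro cform.span_base) auto
    then show "mon (d - j) j \<in> insert (lift d W) (const_form ` T)"
      using const_form_mon[of "d - j" j] by (metis imageI insertI2)
  qed
  finally have "q \<in> tangent_rel d T W" .
  moreover have "scale2 a (lift d W) \<in> tangent_rel d T W"
    unfolding tangent_rel_def by (intro scale2_in_span_over a) simp
  ultimately have "q + scale2 a (lift d W) \<in> tangent_rel d T W"
    unfolding tangent_rel_def by (intro span_over_add regular_add zero_in_regular)
  moreover have "p = (q + scale2 a (lift d W)) + differential d W b"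
    by (simp add: q_def)
  ultimately show ?thesis using b unfolding normal_rel_def by blast
qed

text \<open>An affine function is determined by two values. Taking them at nodes of distance 1 next
  to the point 0 or \<infinity> shows that the coefficients are regular there: this is where the
  curve being an immersion at these points enters.\<close>

lemma normal_rel_iff_affine:
  assumes p: "p \<in> form_sections d W"
  shows "p \<in> normal_rel d T W \<longleftrightarrow> affine p"
proof
  assume "affine p"
  then obtain A B where AB: "\<And>i. i \<le> Suc N \<Longrightarrow> weight d p (\<kappa> i) = A + B * of_nat (\<kappa> i)"
    unfolding affine_def by blast
  have reg: "form_coeff d p j / of_nat (d choose j) \<in> regular W" for j
    by (intro regular_divide_of_nat form_coeff_in_regular p)
  show "p \<in> normal_rel d T W"
  proof (cases "W = U1")
    case False
    \<comment> \<open>The nodes 0 and 1 determine A and B. Since \<open>slope\<close> contains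
      t^(-1), the coefficient of the derivative is t B.\<close>
    have A: "A = form_coeff d p 0" and B: "A + B = fls_X powi (- 1) * (form_coeff d p 1 / of_nat d)"
      using AB[of 0] AB[of 1] ends by (simp_all add: weight_def)
    have "A \<in> regular W" using reg[of 0] A by simp
    moreover have "fls_X * B \<in> regular W"
    proof -
      have "fls_X * fls_X powi (- 1) = (1 :: complex fls)"
        using power_int_add[of "fls_X :: complex fls" 1 "- 1"] by simp
      then have "fls_X * (A + B) = form_coeff d p 1 / of_nat d"
        unfolding B by (simp only: mult.assoc[symmetric] mult_1_left)
      then have "fls_X * B = form_coeff d p 1 / of_nat d - fls_X * A"
        by (simp add: algebra_simps)
      moreover have "form_coeff d p 1 / of_nat d \<in> regular W" using reg[of 1] by simp
      moreover have "fls_X * A \<in> regular W"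
        using regular_X_powi_mult[OF \<open>A \<in> regular W\<close>, of 1] False by simp
      ultimately show ?thesis by (simp add: regular_diff)
    qed
    ultimately show ?thesis
    proof (rule in_normal_rel[OF p])
      fix i assume "i \<le> Suc N"
      then show "weight d p (\<kappa> i) = A * fls_X powi twist d W + fls_X * B * slope d W (\<kappa> i)"
        using False by (cases W) (simp_all add: AB power_int_minus)
    qed
  next
    case True
    \<comment> \<open>On \<open>U1\<close> the nodes d and d - 1 are used. The choice of b solves a
      = t^d (A + B d) and b = - t^(d - 1) B.\<close>
    define a where "a = form_coeff d p d"
    define b where "b = form_coeff d p (\<kappa> N) / of_nat d - fls_X powi (- 1) * a"
    have d: "d > 0" and \<kappa>N: "\<kappa> N = d - 1" using ends by auto
    have choose: "d choose (d - Suc 0) = d"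
      using d binomial_symmetric[of 1 d] by simp
    have a: "A + B * of_nat d = fls_X powi (- int d) * a"
      using AB[of "Suc N"] ends by (simp add: weight_def a_def)
    have "A + B * of_nat (d - 1) = fls_X powi (1 - int d) * (form_coeff d p (\<kappa> N) / of_nat d)"
      using AB[of N] d by (simp add: weight_def \<kappa>N choose of_nat_diff)
    moreover have "fls_X powi (- int d) = (fls_X powi (1 - int d) * fls_X powi (- 1) :: complex fls)"
      using power_int_add[of "fls_X :: complex fls" "1 - int d" "- 1"] by simp
    ultimately have b: "- B = fls_X powi (1 - int d) * b"
      using a d by (simp add: b_def algebra_simps of_nat_diff)
    have "a \<in> regular W" using reg[of d] by (simp add: a_def)
    moreover have "b \<in> regular W"
      unfolding b_def using reg[of "\<kappa> N"] True \<open>a \<in> regular W\<close>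
      by (intro regular_diff regular_X_powi_mult) (auto simp: \<kappa>N choose)
    ultimately show ?thesis
    proof (rule in_normal_rel[OF p])
      fix i assume i: "i \<le> Suc N"
      have "b * slope d W (\<kappa> i) = (fls_X powi (1 - int d) * b) * (of_nat d - of_nat (\<kappa> i))"
        using True by (simp add: mult_ac)
      moreover have "a * fls_X powi twist d W = A + B * of_nat d"
        using True a by (simp add: mult.commute)
      ultimately have "a * fls_X powi twist d W + b * slope d W (\<kappa> i)
          = (A + B * of_nat d) + (- B) * (of_nat d - of_nat (\<kappa> i))"
        unfolding b by simp
      then show "weight d p (\<kappa> i) = a * fls_X powi twist d W + b * slope d W (\<kappa> i)"
        using AB[OF i] by (simp add: algebra_simps)
    qed
  qed
qed (rule affine_normal_rel)

end

section \<open>Global sections\<close>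

text \<open>Second divided difference of \<open>u\<close> at three consecutive nodes, with denominators cleared.\<close>

definition bend :: "(nat \<Rightarrow> nat) \<Rightarrow> (nat \<Rightarrow> 'a::comm_ring_1) \<Rightarrow> nat \<Rightarrow> 'a" where
  "bend \<kappa> u i = (of_nat (\<kappa> (i + 2)) - of_nat (\<kappa> (i + 1))) * u (\<kappa> i)
     - (of_nat (\<kappa> (i + 2)) - of_nat (\<kappa> i)) * u (\<kappa> (i + 1))
     + (of_nat (\<kappa> (i + 1)) - of_nat (\<kappa> i)) * u (\<kappa> (i + 2))"

lemma bend_cong:
  "u (\<kappa> i) = v (\<kappa> i) \<Longrightarrow> u (\<kappa> (i + 1)) = v (\<kappa> (i + 1)) \<Longrightarrow> u (\<kappa> (i + 2)) = v (\<kappa> (i + 2))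
    \<Longrightarrow> bend \<kappa> u i = bend \<kappa> v i"
  by (simp add: bend_def)

lemma bend_affine: "bend \<kappa> (\<lambda>j. a + b * of_nat j) i = 0"
  by (simp add: bend_def algebra_simps)

lemma bend_mult_right: "bend \<kappa> (\<lambda>j. u j * a) i = bend \<kappa> u i * a"
  by (simp add: bend_def algebra_simps)

lemma bend_weight_add:
    "bend \<kappa> (weight d (p + q)) i = bend \<kappa> (weight d p) i + bend \<kappa> (weight d q) i"
  and bend_weight_diff:
    "bend \<kappa> (weight d (p - q)) i = bend \<kappa> (weight d p) i - bend \<kappa> (weight d q) i"
  and bend_weight_scale2: "bend \<kappa> (weight d (scale2 a p)) i = a * bend \<kappa> (weight d p) i"
  by (simp_all add: bend_def weight_add weight_diff weight_scale2 algebra_simps)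

lemma fls_nth_bend:
  fixes u :: "nat \<Rightarrow> 'a::comm_ring_1 fls"
  shows "fls_nth (bend \<kappa> u i) l = bend \<kappa> (\<lambda>j. fls_nth (u j) l) i"
  by (simp add: bend_def fls_of_nat left_diff_distrib)

lemma fls_nth_weight:
  "fls_nth (weight d p j) l = fls_nth (form_coeff d p j / of_nat (d choose j)) (l + int j)"
  by (simp only: weight_def fls_X_powi_times_nth) simp

lemma fls_nth_weight_eq_0:
  assumes "p \<in> form_sections d W"
    and "W = U0 \<and> l < - int j \<or> W = U1 \<and> - int j < l"
  shows "fls_nth (weight d p j) l = 0"
proof -
  have "form_coeff d p j / of_nat (d choose j) \<in> regular W"
    by (intro regular_divide_of_nat form_coeff_in_regular assms(1))
  then show ?thesis
    using assms(2) unfolding fls_nth_weight by force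
qed

lemma form_sections_U01: "p \<in> form_sections d W \<Longrightarrow> p \<in> form_sections d U01"
  by (cases W) (auto simp: form_sections_def)

lemma form_sections_scale2_const:
  "p \<in> form_sections d W \<Longrightarrow> scale2 (fls_const c) p \<in> form_sections d W"
  unfolding form_sections_def forms_def
  by (auto simp: scale2_def regular_const_mult)

lemma form_sections_scale2_X_powi:
  "p \<in> form_sections d U01 \<Longrightarrow> scale2 (fls_X powi n) p \<in> form_sections d U01"
  unfolding form_sections_def forms_def
  by (auto simp: scale2_def simp del: regular.simps intro!: regular_X_powi_mult)

lemma zero_in_form_sections: "0 \<in> form_sections d W"
  by (simp add: form_sections_def forms_def zero_in_regular)

context monomial_curve
begin

lemma less_iff: "i \<le> Suc N \<Longrightarrow> j \<le> Suc N \<Longrightarrow> \<kappa> i < \<kappa> j \<longleftrightarrow> i < j"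
proof -
  have "\<kappa> i < \<kappa> j" if "i < j" "j \<le> Suc N" for i j
    using step[of i] mono[of "Suc i" j] that by simp
  then show "i \<le> Suc N \<Longrightarrow> j \<le> Suc N \<Longrightarrow> \<kappa> i < \<kappa> j \<longleftrightarrow> i < j"
    by (metis less_asym' linorder_neqE_nat)
qed

text \<open>A vanishing bend is a second-order recursion: its last coefficient
  \<open>\<kappa> (i + 1) - \<kappa> i\<close> is nonzero in characteristic 0, so each value follows
  from the two before it, and the values at the nodes 0 and 1 fix A and B.\<close>

lemma affine_iff_bend: "affine p \<longleftrightarrow> (\<forall>i<N. bend \<kappa> (weight d p) i = 0)"
proof
  assume "affine p"
  then obtain A B where AB: "\<And>i. i \<le> Suc N \<Longrightarrow> weight d p (\<kappa> i) = A + B * of_nat (\<kappa> i)"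
    unfolding affine_def by blast
  have "bend \<kappa> (weight d p) i = bend \<kappa> (\<lambda>j. A + B * of_nat j) i" if "i < N" for i
    using that by (intro bend_cong AB) auto
  then show "\<forall>i<N. bend \<kappa> (weight d p) i = 0" by (simp add: bend_affine)
next
  assume bend: "\<forall>i<N. bend \<kappa> (weight d p) i = 0"
  define A where "A = weight d p 0"
  define B where "B = weight d p 1 - A"
  have "weight d p (\<kappa> i) = A + B * of_nat (\<kappa> i)" if "i \<le> Suc N" for i
    using that
  proof (induction i rule: less_induct)
    case (less i)
    consider "i = 0" | "i = 1" | k where "i = k + 2"
      by (metis add_2_eq_Suc' less_2_cases_iff less_iff_Suc_add not_less_eq One_nat_def old.nat.exhaust)
    then show ?case
    proof cases
      case 3
      let ?u = "weight d p" and ?v = "\<lambda>j. A + B * of_nat j :: complex fls"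
      have k: "k < N" using less.prems 3 by simp
      have "?u (\<kappa> k) = ?v (\<kappa> k)" "?u (\<kappa> (k + 1)) = ?v (\<kappa> (k + 1))"
        using less.IH[of k] less.IH[of "k + 1"] less.prems 3 by simp_all
      moreover have "bend \<kappa> ?u k = bend \<kappa> ?v k" using bend k by (simp add: bend_affine)
      ultimately have "(of_nat (\<kappa> (k + 1)) - of_nat (\<kappa> k)) * ?u (\<kappa> (k + 2))
          = (of_nat (\<kappa> (k + 1)) - of_nat (\<kappa> k)) * ?v (\<kappa> (k + 2))"
        unfolding bend_def by simp
      moreover have "(of_nat (\<kappa> (k + 1)) - of_nat (\<kappa> k) :: complex fls) \<noteq> 0"
        using step[of k] k by simp
      ultimately show ?thesis using 3 by simp
    qed (use ends in \<open>simp_all add: A_def B_def\<close>)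
  qed
  then show "affine p" unfolding affine_def by blast
qed

text \<open>Agreement over \<open>U01\<close> means that a difference vanishes in the normal sheaf,
  hence that its bends vanish; as bends are linear over Laurent series, the transition function
  factors out.\<close>

lemma normal_cocycles_iff:
  "(p, q) \<in> normal_cocycles d T n \<longleftrightarrow> p \<in> form_sections d U0 \<and> q \<in> form_sections d U1 \<and>
     (\<forall>i<N. bend \<kappa> (weight d p) i = fls_X powi (int d + n) * bend \<kappa> (weight d q) i)"
proof -
  have "p - scale2 (fls_X powi (int d + n)) q \<in> form_sections d U01"
    if "p \<in> form_sections d U0" "q \<in> form_sections d U1"
    using that by (intro form_sections_diff form_sections_scale2_X_powi form_sections_U01)
  then show ?thesis
    unfolding normal_cocycles_def
    by (auto simp: normal_rel_iff_affine affine_iff_bend bend_weight_diff bend_weight_scale2)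
qed

lemma subspace_normal_cocycles: "cpair.subspace (normal_cocycles d T n)"
  unfolding cpair.subspace_def zero_prod_def
  by (auto simp: normal_cocycles_iff pair_scale_def form_sections_add form_sections_scale2_const
      zero_in_form_sections bend_weight_add bend_weight_scale2 distrib_left mult.left_commute)
     (simp_all add: bend_def weight_def form_coeff_def)

text \<open>The i-th bend of a ramp of slope 1 starting at \<open>\<kappa> (i + 1)\<close>, used to
  normalise the ramps below.\<close>

definition bend_scale :: "nat \<Rightarrow> nat" where
  "bend_scale i = (\<kappa> (i + 1) - \<kappa> i) * (\<kappa> (i + 2) - \<kappa> (i + 1))"

text \<open>
  The two ramps live on opposite sides of \<open>\<kappa> (i + 1)\<close> and their difference is affine, so they
  glue to a section on which only the \<open>i\<close>-th bend is nonzero.  They are cut off at \<open>\<kappa> (i + 2)\<close>,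
  respectively \<open>\<kappa> i\<close>, rather than at \<open>\<kappa> (i + 1)\<close>: strictly between these nodes the coefficients
  are irrelevant modulo \<open>T\<close> but would have poles.
\<close>

definition ramp_up :: "nat \<Rightarrow> int \<Rightarrow> complex fls poly poly" where
  "ramp_up i l = form_of d (\<lambda>j. of_nat (d choose j) * (fls_X powi int j *
     ((if \<kappa> (i + 2) \<le> j then of_nat j - of_nat (\<kappa> (i + 1)) else 0)
        * (fls_X powi l / of_nat (bend_scale i)))))"

definition ramp_down :: "nat \<Rightarrow> int \<Rightarrow> complex fls poly poly" where
  "ramp_down i l = form_of d (\<lambda>j. of_nat (d choose j) * (fls_X powi int j *
     ((if j \<le> \<kappa> i then of_nat (\<kappa> (i + 1)) - of_nat j else 0)
        * (fls_X powi l / of_nat (bend_scale i)))))"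

lemma bend_scale:
  assumes "i < N"
  shows "of_nat (bend_scale i) = (of_nat (\<kappa> (i + 1)) - of_nat (\<kappa> i)) *
      (of_nat (\<kappa> (i + 2)) - of_nat (\<kappa> (i + 1)) :: 'a::ring_1)" "bend_scale i > 0"
  using assms step[of i] step[of "Suc i"] by (auto simp: bend_scale_def of_nat_diff)

lemma bend_ramp:
  assumes i: "i < N" and k: "k < N"
  shows "bend \<kappa> (\<lambda>j. if \<kappa> (i + 2) \<le> j then of_nat j - of_nat (\<kappa> (i + 1)) else 0 :: 'a::comm_ring_1) k
           = (if k = i then of_nat (bend_scale i) else 0)"
    and "bend \<kappa> (\<lambda>j. if j \<le> \<kappa> i then of_nat (\<kappa> (i + 1)) - of_nat j else 0 :: 'a::comm_ring_1) k
           = (if k = i then of_nat (bend_scale i) else 0)"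
proof -
  define u v :: "nat \<Rightarrow> 'a"
    where "u j = (if \<kappa> (i + 2) \<le> j then of_nat j - of_nat (\<kappa> (i + 1)) else 0)"
      and "v j = (if j \<le> \<kappa> i then of_nat (\<kappa> (i + 1)) - of_nat j else 0)" for j
  \<comment> \<open>No node lies strictly between \<open>\<kappa> (i + 1)\<close> and
    \<open>\<kappa> (i + 2)\<close>, and the ramp is zero at the former anyway, so at the nodes the
    displaced cutoff is invisible.\<close>
  have u: "u (\<kappa> j) = (if i + 1 \<le> j then of_nat (\<kappa> j) - of_nat (\<kappa> (i + 1)) else 0)"
    if "j \<le> Suc N" for j
    using less_iff[of j "i + 2"] that i by (cases "j = i + 1") (auto simp: not_less[symmetric] u_def v_def)
  have v: "v (\<kappa> j) = (if j \<le> i + 1 then of_nat (\<kappa> (i + 1)) - of_nat (\<kappa> j) else 0)"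
    if "j \<le> Suc N" for j
    using less_iff[of i j] that i by (cases "j = i + 1") (auto simp: not_less[symmetric] u_def v_def)
  consider "k < i" | "k = i" | "i < k" by linarith
  then have "bend \<kappa> u k = (if k = i then of_nat (bend_scale i) else 0)"
  proof cases
    case 1
    then show ?thesis using k by (cases "i = Suc k") (auto simp: bend_def u)
  next
    case 2
    then show ?thesis using k by (simp add: bend_def u bend_scale)
  next
    case 3
    then have "bend \<kappa> u k = bend \<kappa> (\<lambda>j. - of_nat (\<kappa> (i + 1)) + 1 * of_nat j) k"
      using k by (intro bend_cong) (simp_all only: u, auto)
    then show ?thesis unfolding bend_affine using 3 by simp
  qed
  then show "bend \<kappa> (\<lambda>j. if \<kappa> (i + 2) \<le> j then of_nat j - of_nat (\<kappa> (i + 1)) else 0 :: 'a) k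
      = (if k = i then of_nat (bend_scale i) else 0)" by (simp only: u_def[abs_def])
  consider "k < i" | "k = i" | "i < k" by linarith
  then have "bend \<kappa> v k = (if k = i then of_nat (bend_scale i) else 0)"
  proof cases
    case 3
    then show ?thesis using k by (cases "k = Suc i") (auto simp: bend_def v)
  next
    case 2
    then show ?thesis using k by (simp add: bend_def v bend_scale mult.commute)
  next
    case 1
    then have "bend \<kappa> v k = bend \<kappa> (\<lambda>j. of_nat (\<kappa> (i + 1)) + (- 1) * of_nat j) k"
      using k by (intro bend_cong) (simp_all only: v, auto)
    then show ?thesis unfolding bend_affine using 1 by simp
  qed
  then show "bend \<kappa> (\<lambda>j. if j \<le> \<kappa> i then of_nat (\<kappa> (i + 1)) - of_nat j else 0 :: 'a) k
      = (if k = i then of_nat (bend_scale i) else 0)" by (simp only: v_def[abs_def])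
qed

lemma bend_weight_form_of:
  assumes "k < N"
  shows "bend \<kappa> (weight d (form_of d (\<lambda>j. of_nat (d choose j) * (fls_X powi int j * u j)))) k
    = bend \<kappa> u k"
  using assms by (intro bend_cong weight_form_of le_d) auto

lemma bend_weight_ramp:
  assumes "i < N" "k < N"
  shows "bend \<kappa> (weight d (ramp_up i l)) k = (if k = i then fls_X powi l else 0)"
    and "bend \<kappa> (weight d (ramp_down i l)) k = (if k = i then fls_X powi l else 0)"
  using assms bend_scale(2)[of i]
  by (simp_all only: ramp_up_def ramp_down_def bend_weight_form_of bend_mult_right bend_ramp) auto

text \<open>The cutoff makes \<open>\<kappa> (i + 2)\<close> the least j that occurs, so the bound
  on l is exactly what keeps t^(j + l) free of poles at 0.\<close>

lemma ramp_up_in_form_sections: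
  assumes "i < N" "- int (\<kappa> (i + 2)) \<le> l"
  shows "ramp_up i l \<in> form_sections d U0"
  unfolding ramp_up_def
proof (intro form_of_in_form_sections regular_of_nat_mult)
  fix j assume "j \<le> d"
  have "of_nat (j - \<kappa> (i + 1)) * (fls_X powi (int j + l) * 1) / of_nat (bend_scale i) \<in> regular U0"
    if "\<kappa> (i + 2) \<le> j"
    using that assms
    by (intro regular_divide_of_nat regular_of_nat_mult regular_X_powi_mult one_in_regular) auto
  moreover have "\<kappa> (i + 1) \<le> \<kappa> (i + 2)" using assms by (intro mono) auto
  ultimately show "fls_X powi int j * ((if \<kappa> (i + 2) \<le> j then of_nat j - of_nat (\<kappa> (i + 1)) else 0)
        * (fls_X powi l / of_nat (bend_scale i))) \<in> regular U0"
    using zero_in_regular[of U0]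
    by (simp add: of_nat_diff power_int_add mult_ac del: regular.simps)
qed

text \<open>Dually, the largest j that occurs is \<open>\<kappa> i\<close>, so no positive power of
  t appears.\<close>

lemma ramp_down_in_form_sections:
  assumes "i < N" "l \<le> - int (\<kappa> i)"
  shows "ramp_down i l \<in> form_sections d U1"
  unfolding ramp_down_def
proof (intro form_of_in_form_sections regular_of_nat_mult)
  fix j assume "j \<le> d"
  have "of_nat (\<kappa> (i + 1) - j) * (fls_X powi (int j + l) * 1) / of_nat (bend_scale i) \<in> regular U1"
    if "j \<le> \<kappa> i"
    using that assms
    by (intro regular_divide_of_nat regular_of_nat_mult regular_X_powi_mult one_in_regular) auto
  moreover have "\<kappa> i \<le> \<kappa> (i + 1)" using assms by (intro mono) auto
  ultimately show "fls_X powi int j * ((if j \<le> \<kappa> i then of_nat (\<kappa> (i + 1)) - of_nat j else 0)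
        * (fls_X powi l / of_nat (bend_scale i))) \<in> regular U1"
    using zero_in_regular[of U1]
    by (simp add: of_nat_diff power_int_add mult_ac del: regular.simps)
qed

text \<open>The normal bundle is \<open>\<Oplus>\<^sub>i \<O>(d + \<kappa> (i + 2) - \<kappa> i)\<close>.\<close>

theorem h0_normal_eq:
  "h0_normal d T n = (\<Sum>i<N. nat (int d + n + int (\<kappa> (i + 2)) - int (\<kappa> i) + 1))"
proof -
  define m where "m = int d + n"
  \<comment> \<open>Pairs of a summand i and an exponent l of t allowed in its bend; m is the
    exponent of the transition function.\<close>
  define I where "I = (SIGMA i:{..<N}. {- int (\<kappa> (i + 2))..m - int (\<kappa> i)})"
  \<comment> \<open>Reading the bends of p suffices: gluing determines those of q through the
    invertible factor t^m.\<close>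
  define \<phi> where "\<phi> = (\<lambda>(i, l) (p, q :: complex fls poly poly). fls_nth (bend \<kappa> (weight d p) i) l)"
  define e where "e = (\<lambda>(i, l). (ramp_up i l, ramp_down i (l - m)))"
  have "cpair.quot_dim (normal_cocycles d T n) (normal_null d T) = card I"
  proof (rule cpair.quot_dim_eq_card[where \<phi> = \<phi> and e = e])
    show "cpair.subspace (normal_cocycles d T n)" by (rule subspace_normal_cocycles)
    show "finite I" by (simp add: I_def)
    show "\<phi> x (v + w) = \<phi> x v + \<phi> x w" for x v w
      by (cases x; cases v; cases w) (simp add: \<phi>_def bend_weight_add)
    show "\<phi> x (pair_scale c v) = c * \<phi> x v" for x c v
      by (cases x; cases v) (simp add: \<phi>_def pair_scale_def bend_weight_scale2)
    show "\<phi> x v = 0" if "x \<in> I" "v \<in> normal_null d T" for x v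
      using that affine_normal_rel[of "fst v" U0]
      by (cases x; cases v) (auto simp: \<phi>_def I_def normal_null_def affine_iff_bend)
    show "v \<in> normal_null d T"
      if v: "v \<in> normal_cocycles d T n" and 0: "\<And>x. x \<in> I \<Longrightarrow> \<phi> x v = 0" for v
    proof -
      obtain p q where pq: "v = (p, q)" by (cases v)
      have p: "p \<in> form_sections d U0" and q: "q \<in> form_sections d U1"
        and glue: "\<And>i. i < N \<Longrightarrow> bend \<kappa> (weight d p) i = fls_X powi m * bend \<kappa> (weight d q) i"
        using v unfolding pq normal_cocycles_iff m_def by auto
      have bp: "bend \<kappa> (weight d p) i = 0" if i: "i < N" for i
      proof (rule fls_eqI)
        fix l
        have le: "\<kappa> i \<le> \<kappa> (i + 1)" "\<kappa> (i + 1) \<le> \<kappa> (i + 2)" using i by (auto intro!: mono)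
        \<comment> \<open>Exponents below the range are excluded by regularity of p on
          \<open>U0\<close>, those above it by regularity of q on \<open>U1\<close>.\<close>
        consider "(i, l) \<in> I" | "l < - int (\<kappa> (i + 2))" | "m - int (\<kappa> i) < l"
          using i by (force simp: I_def)
        then have "fls_nth (bend \<kappa> (weight d p) i) l = 0"
        proof cases
          case 1
          then show ?thesis using 0[of "(i, l)"] by (simp add: \<phi>_def pq)
        next
          case 2
          then have "fls_nth (weight d p j) l = 0" if "j \<le> \<kappa> (i + 2)" for j
            using that by (intro fls_nth_weight_eq_0[OF p]) auto
          then show ?thesis using le unfolding fls_nth_bend by (simp add: bend_def)
        next
          case 3
          then have "fls_nth (weight d q j) (l - m) = 0" if "\<kappa> i \<le> j" for j
            using that by (intro fls_nth_weight_eq_0[OF q]) auto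
          then show ?thesis
            using le unfolding glue[OF i] fls_X_powi_times_nth fls_nth_bend by (simp add: bend_def)
        qed
        then show "fls_nth (bend \<kappa> (weight d p) i) l = fls_nth 0 l" by simp
      qed
      moreover have "bend \<kappa> (weight d q) i = 0" if "i < N" for i
        using glue[OF that] bp[OF that] by simp
      ultimately show ?thesis
        using p q by (simp add: pq normal_null_def normal_rel_iff_affine affine_iff_bend)
    qed
    show "e x \<in> normal_cocycles d T n" if x: "x \<in> I" for x
    proof -
      obtain i l where il: "x = (i, l)" by (cases x)
      have "fls_X powi m * fls_X powi (l - m) = (fls_X powi l :: complex fls)"
        using power_int_add[of "fls_X :: complex fls" m "l - m"] by simp
      then show ?thesis using x unfolding il e_def prod.case
        by (subst normal_cocycles_iff)
          (auto simp: I_def bend_weight_ramp ramp_up_in_form_sections ramp_down_in_form_sections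
            simp flip: m_def)
    qed
    show "\<phi> x (e y) = (if x = y then 1 else 0)" if "x \<in> I" "y \<in> I" for x y
      using that by (auto simp: \<phi>_def e_def I_def bend_weight_ramp fls_X_powi_nth split: if_splits)
  qed
  also have "card I = (\<Sum>i<N. nat (m + int (\<kappa> (i + 2)) - int (\<kappa> i) + 1))"
    unfolding I_def by (subst card_SigmaI) (auto intro!: sum.cong simp: algebra_simps)
  finally show ?thesis unfolding h0_normal_def m_def .
qed

end

section \<open>Special vector spaces\<close>

lemma int_nat_eq_pos_part: "int (nat z) = pos_part z"
  by (simp add: pos_part_def)

text \<open>Increasing enumeration of the exponents \<open>j\<close> of the monomials \<open>x\<^bsup>d - j\<^esup> y\<^sup>j\<close> outside \<open>T\<close>.\<close>

definition omitted :: "nat \<Rightarrow> (nat \<Rightarrow> nat) \<Rightarrow> (nat \<Rightarrow> nat) \<Rightarrow> nat \<Rightarrow> nat" where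
  "omitted r \<alpha> \<beta> i = (if i < \<alpha> 1 then i else if i < \<alpha> 1 + r then \<beta> (i + 1 - \<alpha> 1) + 1
     else i + \<beta> r + 2 - (\<alpha> 1 + r))"

locale special_space =
  fixes d r :: nat and \<alpha> \<beta> :: "nat \<Rightarrow> nat" and T :: "complex poly poly set"
  assumes special: "special d r \<alpha> \<beta> T"
begin

text \<open>Among 0, ..., d the exponents omitted by T are \<open>\<alpha> 1\<close> many before the
  first block, r directly after the blocks, and \<open>d - \<beta> r - 1\<close> beyond these: N + 2
  in total.\<close>

abbreviation "N \<equiv> d + \<alpha> 1 + r - \<beta> r - 3"

abbreviation "\<kappa> \<equiv> omitted r \<alpha> \<beta>"

lemma r_ge: "2 \<le> r" and \<alpha>1_ge: "2 \<le> \<alpha> 1" and d_ge: "\<beta> r + 2 \<le> d"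
  and \<alpha>_le_\<beta>: "1 \<le> i \<Longrightarrow> i \<le> r \<Longrightarrow> \<alpha> i \<le> \<beta> i"
  and \<alpha>_Suc: "1 \<le> i \<Longrightarrow> i < r \<Longrightarrow> \<alpha> (Suc i) = \<beta> i + 2"
  and T_eq_span: "T = cform.span {mon (d - j) j | j. j \<in> (\<Union>i\<in>{1..r}. {\<alpha> i..\<beta> i})}"
  using special unfolding special_def by auto

section \<open>Positions of the blocks and of the omitted exponents\<close>

lemma \<beta>_less_\<alpha>:
  assumes "1 \<le> i" "i < j" "j \<le> r"
  shows "\<beta> i + 2 \<le> \<alpha> j"
proof -
  have "Suc i \<le> j" using assms by simp
  then show ?thesis using assms(3)
  proof (induction j rule: dec_induct)
    case base
    then show ?case using assms(1) \<alpha>_Suc[of i] by simp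
  next
    case (step j)
    then show ?case using assms(1) \<alpha>_Suc[of j] \<alpha>_le_\<beta>[of j] by simp
  qed
qed

lemma \<alpha>1_le: "1 \<le> i \<Longrightarrow> i \<le> r \<Longrightarrow> \<alpha> 1 \<le> \<alpha> i"
  using \<beta>_less_\<alpha>[of 1 i] \<alpha>_le_\<beta>[of 1] by (cases "i = 1") auto

lemma \<beta>_le: "1 \<le> i \<Longrightarrow> i \<le> r \<Longrightarrow> \<beta> i \<le> \<beta> r"
  using \<beta>_less_\<alpha>[of i r] \<alpha>_le_\<beta>[of r] by (cases "i = r") auto

text \<open>The omitted exponents bordering the blocks have consecutive indices starting at
  \<open>\<alpha> 1 - 1\<close>. For 0 < t < r the one at index \<open>\<alpha> 1 - 1 + t\<close>
  follows block t and also precedes block t + 1, whence the two formulas for it.\<close>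

lemma \<kappa>_eq_\<beta>: "1 \<le> t \<Longrightarrow> t \<le> r \<Longrightarrow> \<kappa> (\<alpha> 1 - 1 + t) = \<beta> t + 1"
  using \<alpha>1_ge by (auto simp: omitted_def)

lemma \<kappa>_eq_\<alpha>: "t < r \<Longrightarrow> \<kappa> (\<alpha> 1 - 1 + t) = \<alpha> (Suc t) - 1"
  using \<alpha>1_ge \<kappa>_eq_\<beta>[of t] \<alpha>_Suc[of t] by (cases "t = 0") (auto simp: omitted_def)

lemma \<kappa>_low: "i < \<alpha> 1 \<Longrightarrow> \<kappa> i = i"
  by (simp add: omitted_def)

lemma \<kappa>_high: "\<kappa> (\<alpha> 1 - 1 + r + i) = \<beta> r + 1 + i"
  using \<kappa>_eq_\<beta>[of r] r_ge \<alpha>1_ge by (cases "i = 0") (auto simp: omitted_def)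

lemma index_cases:
  obtains "i < \<alpha> 1 - 1" | t where "t < r" "i = \<alpha> 1 - 1 + t" | t where "i = \<alpha> 1 - 1 + r + t"
proof -
  consider "i < \<alpha> 1 - 1" | "\<alpha> 1 - 1 \<le> i" "i < \<alpha> 1 - 1 + r" | "\<alpha> 1 - 1 + r \<le> i" by linarith
  then show thesis using that by cases (auto simp: le_iff_add)
qed

lemma \<kappa>_step: "\<kappa> i < \<kappa> (Suc i)"
proof (cases i rule: index_cases)
  case 1
  then show ?thesis by (simp add: \<kappa>_low)
next
  case (2 t)
  then show ?thesis
    using \<kappa>_eq_\<alpha>[of t] \<kappa>_eq_\<beta>[of "Suc t"] \<alpha>_le_\<beta>[of "Suc t"] \<alpha>1_le[of "Suc t"] \<alpha>1_ge by simp
next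
  case (3 t)
  then show ?thesis using \<kappa>_high[of t] \<kappa>_high[of "Suc t"] by simp
qed

lemma block_cases:
  assumes "\<alpha> 1 \<le> j" "j \<le> \<beta> r + 1"
  obtains i where "1 \<le> i" "i \<le> r" "\<alpha> i \<le> j" "j \<le> \<beta> i + 1"
proof -
  \<comment> \<open>The first block that reaches j when the omitted exponent after it is included;
    minimality gives \<open>\<beta> (i - 1) + 2 \<le> j\<close>, and the left side is
    \<open>\<alpha> i\<close>.\<close>
  define i where "i = (LEAST i. 1 \<le> i \<and> j \<le> \<beta> i + 1)"
  have ex: "1 \<le> r \<and> j \<le> \<beta> r + 1" using r_ge assms by simp
  have i: "1 \<le> i" "j \<le> \<beta> i + 1" "i \<le> r"
    using LeastI[of "\<lambda>i. 1 \<le> i \<and> j \<le> \<beta> i + 1", OF ex]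
      Least_le[of "\<lambda>i. 1 \<le> i \<and> j \<le> \<beta> i + 1", OF ex] by (auto simp: i_def)
  have "\<alpha> i \<le> j"
  proof (cases "i = 1")
    case False
    then have "\<not> j \<le> \<beta> (i - 1) + 1"
      using not_less_Least[of "i - 1" "\<lambda>i. 1 \<le> i \<and> j \<le> \<beta> i + 1"] i by (auto simp: i_def)
    then show ?thesis using \<alpha>_Suc[of "i - 1"] False i by simp
  qed (use assms in simp)
  then show thesis using i that by blast
qed

lemma \<kappa>_image: "(\<Union>i\<in>{1..r}. {\<alpha> i..\<beta> i}) = {j. j \<le> d \<and> j \<notin> \<kappa> ` {..Suc N}}"
proof (intro set_eqI iffI)
  fix j assume "j \<in> (\<Union>i\<in>{1..r}. {\<alpha> i..\<beta> i})"
  then obtain i where i: "1 \<le> i" "i \<le> r" "\<alpha> i \<le> j" "j \<le> \<beta> i" by auto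
  have "j \<noteq> \<kappa> x" for x
  proof (cases x rule: index_cases)
    case 1
    then show ?thesis using i \<alpha>1_le[of i] by (simp add: \<kappa>_low)
  next
    case (2 t)
    show ?thesis
    proof (cases "t = 0")
      case True
      then show ?thesis using 2 i \<alpha>1_le[of i] \<alpha>1_ge by (simp add: \<kappa>_low)
    next
      case False
      then have "\<kappa> x = \<beta> t + 1" using 2 \<kappa>_eq_\<beta>[of t] by simp
      moreover have "\<beta> i + 2 \<le> \<beta> t" if "i < t"
        using \<beta>_less_\<alpha>[of i t] \<alpha>_le_\<beta>[of t] that i 2 False by simp
      moreover have "\<beta> t + 2 \<le> \<alpha> i" if "t < i"
        using \<beta>_less_\<alpha>[of t i] that i False by simp
      ultimately show ?thesis using i by (cases t i rule: linorder_cases) auto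
    qed
  next
    case (3 t)
    then show ?thesis using \<kappa>_high[of t] \<beta>_le[of i] i by simp
  qed
  moreover have "j \<le> d" using \<beta>_le[of i] i d_ge by simp
  ultimately show "j \<in> {j. j \<le> d \<and> j \<notin> \<kappa> ` {..Suc N}}" by blast
next
  fix j assume "j \<in> {j. j \<le> d \<and> j \<notin> \<kappa> ` {..Suc N}}"
  then have j: "j \<le> d" "\<And>x. x \<le> Suc N \<Longrightarrow> j \<noteq> \<kappa> x" by auto
  \<comment> \<open>Before the first block and beyond \<open>\<beta> r + 1\<close> every exponent up
    to d is a node with an explicit index at most N + 1.\<close>
  have "\<alpha> 1 \<le> j"
    using \<kappa>_low[of j] j(2)[of j] d_ge r_ge \<alpha>_le_\<beta>[of 1] \<beta>_le[of 1] by linarith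
  moreover have "j \<le> \<beta> r + 1"
  proof (rule ccontr)
    assume "\<not> j \<le> \<beta> r + 1"
    then have "\<kappa> (\<alpha> 1 - 1 + r + (j - \<beta> r - 1)) = j" using \<kappa>_high[of "j - \<beta> r - 1"] by simp
    moreover have "\<alpha> 1 - 1 + r + (j - \<beta> r - 1) \<le> Suc N" using \<open>\<not> j \<le> \<beta> r + 1\<close> j(1) \<alpha>1_ge r_ge by simp
    ultimately show False using j(2) by metis
  qed
  ultimately obtain i where i: "1 \<le> i" "i \<le> r" "\<alpha> i \<le> j" "j \<le> \<beta> i + 1"
    by (rule block_cases)
  moreover have "\<alpha> 1 - 1 + i \<le> Suc N" using i d_ge \<alpha>1_ge by simp
  then have "j \<noteq> \<beta> i + 1" using j(2)[of "\<alpha> 1 - 1 + i"] \<kappa>_eq_\<beta>[of i] i by simp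
  ultimately show "j \<in> (\<Union>i\<in>{1..r}. {\<alpha> i..\<beta> i})" by auto
qed

text \<open>The bounds \<open>2 \<le> \<alpha> 1\<close> and \<open>\<beta> r + 2 \<le> d\<close>
  keep the exponents 0, 1, d - 1 and d outside T, which gives the conditions at the ends.\<close>

sublocale monomial_curve d N \<kappa> T
proof
  have "T = cform.span {mon (d - j) j | j. j \<in> {j. j \<le> d \<and> j \<notin> \<kappa> ` {..Suc N}}}"
    using T_eq_span unfolding \<kappa>_image .
  then show "T = cform.span {mon (d - j) j | j. j \<le> d \<and> j \<notin> \<kappa> ` {..Suc N}}"
    by (simp only: mem_Collect_eq)
  show "\<kappa> 0 = 0" "\<kappa> 1 = 1" using \<alpha>1_ge by (auto simp: \<kappa>_low)
  have "N = \<alpha> 1 - 1 + r + (d - \<beta> r - 2)" "Suc N = \<alpha> 1 - 1 + r + (d - \<beta> r - 1)"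
    using d_ge \<alpha>1_ge by auto
  then have "\<kappa> N = \<beta> r + 1 + (d - \<beta> r - 2)" "\<kappa> (Suc N) = \<beta> r + 1 + (d - \<beta> r - 1)"
    by (simp_all only: \<kappa>_high)
  then show "Suc (\<kappa> N) = d" "\<kappa> (Suc N) = d"
    using d_ge by linarith+
qed (rule \<kappa>_step)

text \<open>After the twist, the summand over two consecutive gaps of sum z has degree z - k - 2, so
  it contributes \<open>pos_part (z - k - 1)\<close>. Two gaps of length 1 give 0; the sums that
  remain are \<open>b 1 + 3\<close>, \<open>b i + b (i + 1) + 4\<close> and
  \<open>b r + 3\<close>.\<close>

lemma phi_eq:
  assumes b: "\<And>i. 1 \<le> i \<Longrightarrow> i \<le> r \<Longrightarrow> part \<alpha> \<beta> i = b i + 2" and k: "1 \<le> k"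
  shows "phi d T k = pos_part (int (b 1) + 2 - k) + pos_part (int (b r) + 2 - k)
    + (\<Sum>i=1..r-1. pos_part (int (b i) + int (b (i + 1)) + 3 - k))"
proof -
  define g where "g i = nat (int (\<kappa> (i + 2)) - int (\<kappa> i) - k - 1)" for i
  \<comment> \<open>Index \<open>\<alpha> 1 - 2\<close> is the first whose two gaps include a block;
    there are r + 1 such indices, numbered by t from 0 to r.\<close>
  define h where "h t = g (t + (\<alpha> 1 - 2))" for t
  have \<beta>: "\<beta> i = \<alpha> i + b i" if "1 \<le> i" "i \<le> r" for i
    using b[OF that] \<alpha>_le_\<beta>[OF that] by (simp add: part_def)
  have "phi d T k = int (\<Sum>i<N. g i)"
    unfolding phi_def h0_normal_eq g_def
    by (intro arg_cong[where f = int] sum.cong) (auto intro: arg_cong[where f = nat])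
  also have "(\<Sum>i<N. g i) = (\<Sum>i\<in>{0 + (\<alpha> 1 - 2)..<Suc r + (\<alpha> 1 - 2)}. g i)"
  proof (rule sum.mono_neutral_right)
    show "{0 + (\<alpha> 1 - 2)..<Suc r + (\<alpha> 1 - 2)} \<subseteq> {..<N}" using d_ge \<alpha>1_ge by auto
    show "\<forall>i\<in>{..<N} - {0 + (\<alpha> 1 - 2)..<Suc r + (\<alpha> 1 - 2)}. g i = 0"
    proof
      fix i assume i: "i \<in> {..<N} - {0 + (\<alpha> 1 - 2)..<Suc r + (\<alpha> 1 - 2)}"
      show "g i = 0"
      proof (cases i rule: index_cases)
        case 1
        then have "i + 2 < \<alpha> 1" using i by auto
        then show ?thesis using k by (simp add: g_def \<kappa>_low)
      next
        case (2 t)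
        then show ?thesis using i \<alpha>1_ge by auto
      next
        case (3 t)
        then show ?thesis using \<kappa>_high[of t] \<kappa>_high[of "t + 2"] k by (simp add: g_def)
      qed
    qed
  qed simp
  also have "\<dots> = (\<Sum>t<Suc r. h t)"
    unfolding sum.shift_bounds_nat_ivl h_def atLeast0LessThan ..
  \<comment> \<open>The first and the last of these pair a block with a gap of length 1; the inner
    ones pair neighbouring blocks.\<close>
  also have "Suc r = Suc (Suc (r - 1))" using r_ge by simp
  also have "(\<Sum>t<Suc (Suc (r - 1)). h t) = h 0 + (\<Sum>t<r - 1. h (Suc t)) + h r"
    by (subst sum.lessThan_Suc, subst sum.lessThan_Suc_shift) (use r_ge in simp)
  also have "h 0 = nat (int (b 1) + 2 - k)"
  proof -
    have "\<alpha> 1 - 1 + 1 = \<alpha> 1 - 2 + 2" using \<alpha>1_ge by simp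
    then have "\<kappa> (\<alpha> 1 - 2 + 2) = \<beta> 1 + 1" using \<kappa>_eq_\<beta>[of 1] r_ge by simp
    then show ?thesis using \<kappa>_low[of "\<alpha> 1 - 2"] \<alpha>1_ge \<beta>[of 1] r_ge
      by (simp add: h_def g_def of_nat_diff)
  qed
  also have "h r = nat (int (b r) + 2 - k)"
  proof -
    have "r + (\<alpha> 1 - 2) = \<alpha> 1 - 1 + (r - 1)" "r + (\<alpha> 1 - 2) + 2 = \<alpha> 1 - 1 + r + 1"
      using r_ge \<alpha>1_ge by simp_all
    then have "\<kappa> (r + (\<alpha> 1 - 2)) = \<alpha> r - 1" "\<kappa> (r + (\<alpha> 1 - 2) + 2) = \<beta> r + 2"
      using \<kappa>_eq_\<alpha>[of "r - 1"] \<kappa>_high[of 1] r_ge by simp_all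
    then show ?thesis using \<alpha>1_ge \<alpha>1_le[of r] \<beta>[of r] r_ge by (simp add: h_def g_def of_nat_diff)
  qed
  also have "(\<Sum>t<r - 1. h (Suc t)) = (\<Sum>t<r - 1. nat (int (b (Suc t)) + int (b (Suc t + 1)) + 3 - k))"
  proof (intro sum.cong refl)
    fix t assume "t \<in> {..<r - 1}"
    then have t: "Suc (Suc t) \<le> r" by auto
    have "Suc t + (\<alpha> 1 - 2) = \<alpha> 1 - 1 + t" "Suc t + (\<alpha> 1 - 2) + 2 = \<alpha> 1 - 1 + (t + 2)"
      using \<alpha>1_ge by simp_all
    then have "\<kappa> (Suc t + (\<alpha> 1 - 2)) = \<alpha> (Suc t) - 1"
      "\<kappa> (Suc t + (\<alpha> 1 - 2) + 2) = \<beta> (Suc (Suc t)) + 1"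
      using \<kappa>_eq_\<alpha>[of t] \<kappa>_eq_\<beta>[of "t + 2"] t by simp_all
    then show "h (Suc t) = nat (int (b (Suc t)) + int (b (Suc t + 1)) + 3 - k)"
      using \<alpha>1_ge \<alpha>1_le[of "Suc t"] \<beta>[of "Suc t"] \<beta>[of "Suc (Suc t)"] \<alpha>_Suc[of "Suc t"] t
      by (simp add: h_def g_def of_nat_diff algebra_simps)
  qed
  also have "\<dots> = (\<Sum>i=1..r-1. nat (int (b i) + int (b (i + 1)) + 3 - k))"
    by (simp add: sum.atLeast1_atMost_eq)
  finally show ?thesis
    by (simp only: of_nat_add of_nat_sum int_nat_eq_pos_part ac_simps)
qed

end

text \<open>Riemann-Roch for a line bundle of degree z - 1 on the projective line: h^0 is the Euler
  characteristic z plus h^1. It separates the linear part of the formula from its correction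
  terms.\<close>

lemma pos_part_eq_add: "pos_part z = z + pos_part (- z)"
  by (simp add: pos_part_def)

text \<open>The kink is at c, while the forward second difference is centred at k + 1; hence the
  shift to c - 1.\<close>

lemma second_diff_pos_part: "second_diff (\<lambda>k. pos_part (c - k)) k = kronecker k (c - 1)"
  by (auto simp: second_diff_def pos_part_def kronecker_def max_def)

theorem theorem5p4:
  fixes d s e r lam :: nat and \<alpha> \<beta> b :: "nat \<Rightarrow> nat"
    and m :: "nat \<Rightarrow> complex poly poly" and T :: "complex poly poly set"
  assumes "3 \<le> s" and "s < d"
    and "T \<inter> rnc_cone d = {}"
    and "cform.dim T = e + 1" and "e + 1 = d - s"
    and "special d r \<alpha> \<beta> T"
    and "\<forall>i\<in>{1..r}. part \<alpha> \<beta> i = b i + 2"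
    and "\<forall>i\<in>{1..r}. m i = mon (d - \<alpha> i) (\<beta> i)"
    and "internal_direct_sum {1..r} (\<lambda>i. (partial ^^ b i) (cform.span {m i})) T"
    and "lam = height r \<alpha> \<beta>" and "lam = e + 1 + r"
  shows "\<forall>k::int. 2 \<le> k \<and> k \<le> int lam \<longrightarrow>
           phi d T k =
             (\<Sum>i=1..r. (int (b i) - k + 1)) + int lam - k + 1
             + (\<Sum>i=1..r-1. pos_part (k - int (b (i+1)) - int (b i) - 3))
             + pos_part (k - int (b 1) - 2) + pos_part (k - int (b r) - 2)
         \<and> second_diff (phi d T) k =
             (\<Sum>i=1..r-1. kronecker k (int (b i) + int (b (i+1)) + 2))
             + kronecker k (int (b 1) + 1) + kronecker k (int (b r) + 1)"
proof (intro allI impI conjI)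
  fix k :: int assume k: "2 \<le> k \<and> k \<le> int lam"
  interpret special_space d r \<alpha> \<beta> T using assms(6) by (rule special_space.intro)
  have phi: "phi d T l = pos_part (int (b 1) + 2 - l) + pos_part (int (b r) + 2 - l)
      + (\<Sum>i=1..r-1. pos_part (int (b i) + int (b (i + 1)) + 3 - l))" if "1 \<le> l" for l
    using assms(7) that by (intro phi_eq) auto
  have lam: "int lam = (\<Sum>i=1..r. int (b i)) + 2 * int r"
    using assms(7,10) by (simp add: height_def sum.distrib)
  obtain q where q: "r = Suc q" using r_ge by (cases r) auto
  \<comment> \<open>The sum over neighbouring pairs counts each \<open>b i\<close> twice except
    \<open>b 1\<close> and \<open>b r\<close>, whose second copies come from the two boundary
    terms.\<close>
  have last: "(\<Sum>i=1..r. int (b i)) = (\<Sum>i=1..r-1. int (b i)) + int (b r)"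
    by (simp add: q)
  have first: "(\<Sum>i=1..r. int (b i)) = int (b 1) + (\<Sum>i=1..r-1. int (b (i + 1)))"
    unfolding q One_nat_def sum.atLeast1_atMost_eq sum.lessThan_Suc_shift by simp
  have "(\<Sum>i=1..r-1. pos_part (int (b i) + int (b (i + 1)) + 3 - k))
      = (\<Sum>i=1..r-1. int (b i) + int (b (i + 1)) + 3 - k
          + pos_part (k - int (b (i+1)) - int (b i) - 3))"
    by (intro sum.cong refl) (subst pos_part_eq_add, simp add: algebra_simps)
  also have "\<dots> = (\<Sum>i=1..r-1. int (b i)) + (\<Sum>i=1..r-1. int (b (i + 1))) + (int r - 1) * (3 - k)
      + (\<Sum>i=1..r-1. pos_part (k - int (b (i+1)) - int (b i) - 3))"
    by (simp add: sum.distrib sum_subtractf q algebra_simps)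
  finally show "phi d T k =
             (\<Sum>i=1..r. (int (b i) - k + 1)) + int lam - k + 1
             + (\<Sum>i=1..r-1. pos_part (k - int (b (i+1)) - int (b i) - 3))
             + pos_part (k - int (b 1) - 2) + pos_part (k - int (b r) - 2)"
    using k phi[of k] last first lam
      pos_part_eq_add[of "int (b 1) + 2 - k"] pos_part_eq_add[of "int (b r) + 2 - k"]
    by (simp add: sum.distrib sum_subtractf algebra_simps)
  let ?f = "\<lambda>c l. pos_part (c - l)"
  \<comment> \<open>The formula \<open>phi\<close> holds for every argument from 1 on, so it applies
    at k, k + 1 and k + 2 even when these exceed the height.\<close>
  have "second_diff (phi d T) k = second_diff (?f (int (b 1) + 2)) k
      + second_diff (?f (int (b r) + 2)) k
      + (\<Sum>i=1..r-1. second_diff (?f (int (b i) + int (b (i + 1)) + 3)) k)"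
    using k by (simp add: second_diff_def phi sum.distrib sum_subtractf sum_distrib_left)
  then show "second_diff (phi d T) k =
             (\<Sum>i=1..r-1. kronecker k (int (b i) + int (b (i+1)) + 2))
             + kronecker k (int (b 1) + 1) + kronecker k (int (b r) + 1)"
    by (simp add: second_diff_pos_part ac_simps)
qed

end
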